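(* Let $(N_0,N_1,N_2,\ldots)$ be an infinite sequence of positive integers of at most polynomial growth (i.e., there are constants $a,p\ge0$ with $N_i\le a(i+1)^p$ for all $i$). For each $n$ let $\bm{N}^{(n)}=(N_0,\ldots,N_{n-1},-\sum_{i=0}^{n-1}N_i)\in\mathbb{Z}^{n+1}$. Then \[ \lim_{n\to\infty}\frac{\log K_n(\bm{N}^{(n)})}{\sup_{\bm{f}\in\mathcal{F}_n(\bm{N}^{(n)})}\mathcal{H}(\bm{f})}=1. \]
   Context: $\mathcal{F}_n(\bm{N})$ is the set of $\bm{f}=(f_{ij})_{0\le i<j\le n}\in\mathbb{R}_{\ge0}^{\binom{n+1}{2}}$ with $\sum_{j>i} f_{ij}-\sum_{k<i} f_{ki}=N_i$ for every $i\in\{0,\ldots,n\}$, and $K_n(\bm{N})$ is its number of integer points. Let $h(t):=(t+1)\log(t+1)-t\log t$ ($0\log0=0$), and for $\bm{f}\in\mathcal{F}_n(\bm{N})$ define the flow entropy $\mathcal{H}(\bm{f}):=\sum_{0\le i<j\le n} h(f_{ij})+\sum_{0<j<n} h\big(\sum_{0\le i<j}(N_i-f_{ij})\big)$. *)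

theory Defs
  imports Complex_Main
begin

text \<open>A flow vector is a function f on pairs (i,j) with 0 <= i < j <= n;
  it is required to vanish outside this index set, so that it represents an
  element of R^(binom (n+1) 2).  N is a vector indexed by {0..n}.\<close>

definition flow_polytope :: "nat \<Rightarrow> (nat \<Rightarrow> int) \<Rightarrow> (nat \<Rightarrow> nat \<Rightarrow> real) set" where
  "flow_polytope n N = {f.
     (\<forall>i j. \<not> (i < j \<and> j \<le> n) \<longrightarrow> f i j = 0) \<and>
     (\<forall>i j. i < j \<and> j \<le> n \<longrightarrow> f i j \<ge> 0) \<and>
     (\<forall>i \<le> n. (\<Sum>j\<in>{i<..n}. f i j) - (\<Sum>k<i. f k i) = of_int (N i))}"

definition lattice_count :: "nat \<Rightarrow> (nat \<Rightarrow> int) \<Rightarrow> nat" where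
  "lattice_count n N = card {f \<in> flow_polytope n N. \<forall>i j. f i j \<in> \<int>}"

definition hfun :: "real \<Rightarrow> real" where
  "hfun t = (t + 1) * ln (t + 1) - (if t = 0 then 0 else t * ln t)"

definition flow_entropy :: "nat \<Rightarrow> (nat \<Rightarrow> int) \<Rightarrow> (nat \<Rightarrow> nat \<Rightarrow> real) \<Rightarrow> real" where
  "flow_entropy n N f =
     (\<Sum>j\<in>{1..n}. \<Sum>i<j. hfun (f i j)) +
     (\<Sum>j\<in>{0<..<n}. hfun (\<Sum>i<j. (of_int (N i) - f i j)))"

definition netflow_vec :: "(nat \<Rightarrow> int) \<Rightarrow> nat \<Rightarrow> nat \<Rightarrow> int" where
  "netflow_vec N n i = (if i < n then N i else if i = n then - (\<Sum>k<n. N k) else 0)"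

end

theory Submission
  imports Defs "HOL-Library.FuncSet" "HOL-Real_Asymp.Real_Asymp"
begin

text \<open>
  For independent geometric variables with means \<open>t e\<close>, \<open>hfun (t e)\<close> is the entropy of
  the component at \<open>e\<close>.  Gibbs' inequality against this law, with \<open>t\<close> the average
  of all integer flows, gives \<open>ln K \<le> sup H\<close>.

  For the converse, write \<open>T i\<close> for the sum of the first \<open>i + 1\<close> netflows.  Flow conservation says
  that the flow across the cut between \<open>i\<close> and \<open>i + 1\<close> is \<open>T i\<close>.  Hence the arcs
  \<open>(i, i + 1)\<close> act as slack variables, and integer flows correspond to integer points of a packing
  polytope with one inequality per cut in the remaining arcs.  Given a flow \<open>f\<close>, take independent
  geometric variables with means \<open>(1 - \<epsilon>) * f\<close>.  By Markov's inequality each cut inequality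
  holds with probability at least \<open>\<epsilon>\<close>; these are decreasing events, so by
  Harris' inequality all \<open>n\<close> of them hold with probability at least \<open>\<epsilon> ^ n\<close>.
  Hoelder's inequality with exponent \<open>1 + \<theta>\<close> turns this into a lower bound for the number of
  packings in terms of Renyi entropies, which for \<open>\<theta> = o(1 / ln n)\<close> are asymptotic
  to the Shannon entropies except on arcs that carry negligible flow.  All losses other than the factor
  \<open>1 - o(1)\<close> are \<open>o(n * (ln n)\<^sup>2)\<close>, whereas \<open>sup H\<close> is at
  least of order \<open>n * (ln n)\<^sup>2\<close>, as the flow
  \<open>f k j = 1 / (j - k)\<close> for \<open>n / 3 \<le> k < 2 * n / 3\<close>, \<open>2 \<le> j - k \<le> n / 3\<close> shows.
\<close>

subsection \<open>Entropy of the geometric distribution\<close>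

text \<open>Splits the entropy into a growing logarithm and a summand between 0 and 1; the estimates
  below treat the two separately.\<close>

lemma hfun_altdef:
  assumes "t \<ge> 0"
  shows "hfun t = ln (1 + t) + t * ln (1 + 1 / t)"
proof (cases "t = 0")
  case False
  with assms have "t > 0" by simp
  then have "ln (1 + 1 / t) = ln (1 + t) - ln t"
    using ln_div [of "1 + t" t] by (simp add: add_divide_distrib add.commute)
  then have "t * ln (1 + 1 / t) = t * ln (1 + t) - t * ln t"
    by (simp only: right_diff_distrib)
  with \<open>t > 0\<close> show ?thesis
    by (simp add: hfun_def algebra_simps)
qed (simp add: hfun_def)

lemma hfun_nonneg: "t \<ge> 0 \<Longrightarrow> hfun t \<ge> 0"
  by (simp add: hfun_altdef)

lemma mult_ln_one_plus_inverse_le: "t \<ge> 0 \<Longrightarrow> t * ln (1 + 1 / t) \<le> (1::real)"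
  using mult_left_mono [OF ln_add_one_self_le_self [of "1 / t"], of t]
  by (cases "t = 0") auto

lemma hfun_le:
  assumes "0 \<le> t" "t \<le> b"
  shows "hfun t \<le> ln (1 + b) + 1"
proof -
  have "ln (1 + t) \<le> ln (1 + b)"
    using assms by simp
  then show ?thesis
    using mult_ln_one_plus_inverse_le [of t] assms(1) unfolding hfun_altdef [OF assms(1)] by linarith
qed

text \<open>Makes arcs with tiny flow harmless: flow below \<open>1 / n^2\<close> contributes at
  most \<open>3 / n\<close>, and there are at most \<open>n^2\<close> arcs.\<close>

lemma hfun_le_sqrt:
  assumes "0 \<le> t" "t \<le> 1"
  shows "hfun t \<le> 3 * sqrt t"
proof (cases "t = 0")
  case False
  with assms have t: "t > 0" by simp
  \<comment> \<open>Comparison with a square gives \<open>ln (1 + 1 / t) \<le> 2 / sqrt t\<close>,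
    and the factor \<open>t\<close> leaves \<open>2 * sqrt t\<close>.\<close>
  have "1 + 1 / t \<le> (1 + 1 / sqrt t)\<^sup>2"
    using t by (simp add: power2_eq_square field_simps)
  then have "ln (1 + 1 / t) \<le> ln ((1 + 1 / sqrt t)\<^sup>2)"
    using t by (intro ln_mono) (auto intro: add_pos_pos)
  also have "\<dots> = 2 * ln (1 + 1 / sqrt t)"
    using t by (subst ln_realpow) (auto intro: add_pos_pos)
  also have "\<dots> \<le> 2 * (1 / sqrt t)"
    using ln_add_one_self_le_self [of "1 / sqrt t"] t by simp
  finally have "t * ln (1 + 1 / t) \<le> t * (2 * (1 / sqrt t))"
    using t by (intro mult_left_mono) auto
  also have "\<dots> = 2 * sqrt t"
    using t by (simp add: field_simps)
  finally have 1: "t * ln (1 + 1 / t) \<le> 2 * sqrt t" .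
  have "ln (1 + t) \<le> t"
    using t by (intro ln_add_one_self_le_self) auto
  also have "t \<le> sqrt t"
    using assms by (intro real_le_rsqrt) (simp add: power2_eq_square mult_left_le)
  finally show ?thesis
    using 1 t by (simp add: hfun_altdef)
qed (simp add: hfun_def)

text \<open>Concavity of \<open>hfun\<close> together with \<open>hfun 0 = 0\<close>. For the first
  summand of \<open>hfun_altdef\<close> this is concavity of \<open>ln\<close>; the second only
  needs \<open>1 / (c * t) \<ge> 1 / t\<close>.\<close>

lemma hfun_scale:
  assumes "0 \<le> t" "0 \<le> c" "c \<le> 1"
  shows "c * hfun t \<le> hfun (c * t)"
proof (cases "c * t = 0")
  case False
  with assms have pos: "c > 0" "t > 0" by auto
  have d: "1 + c * t > 0" using pos by (simp add: add_pos_pos)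
  \<comment> \<open>Tangent to \<open>ln\<close> at \<open>1 + c * t\<close>, the mean of
    \<open>1 + t\<close> and \<open>1\<close> with weights \<open>c\<close> and
    \<open>1 - c\<close>; hence the linear terms cancel.\<close>
  have "c * (ln (1 + t) - ln (1 + c * t)) \<le> c * ((1 + t - (1 + c * t)) / (1 + c * t))"
    using pos d by (intro mult_left_mono ln_diff_le) auto
  moreover have "(1 - c) * (ln 1 - ln (1 + c * t)) \<le> (1 - c) * ((1 - (1 + c * t)) / (1 + c * t))"
    using assms d by (intro mult_left_mono ln_diff_le) auto
  moreover have "c * ((1 + t - (1 + c * t)) / (1 + c * t)) +
      (1 - c) * ((1 - (1 + c * t)) / (1 + c * t)) = 0"
    using d by (simp add: divide_simps) (simp add: algebra_simps)
  ultimately have "c * ln (1 + t) \<le> ln (1 + c * t)"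
    by (simp add: algebra_simps)
  moreover have "ln (1 + 1 / t) \<le> ln (1 + 1 / (c * t))"
  proof -
    have "1 / t \<le> 1 / (c * t)"
      using assms pos by (intro divide_left_mono) (auto simp: mult_le_cancel_right1)
    then show ?thesis using pos by (subst ln_le_cancel_iff) (auto intro: add_pos_pos)
  qed
  then have "c * (t * ln (1 + 1 / t)) \<le> c * t * ln (1 + 1 / (c * t))"
    using pos by simp
  ultimately show ?thesis
    using assms by (simp add: hfun_altdef algebra_simps)
qed (use assms in \<open>auto simp: hfun_def\<close>)

section \<open>Geometric laws on the naturals, parametrised by their mean\<close>

definition geom_weight :: "real \<Rightarrow> nat \<Rightarrow> real" where
  "geom_weight t a = t ^ a / (1 + t) ^ Suc a"

lemma geom_weight_nonneg: "t \<ge> 0 \<Longrightarrow> geom_weight t a \<ge> 0"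
  by (simp add: geom_weight_def)

text \<open>The success probability is \<open>1 / (1 + t)\<close>, so the second summand is the
  probability of a value at least \<open>M\<close>.\<close>

lemma sum_geom_weight:
  assumes "t \<ge> 0"
  shows "(\<Sum>a<M. geom_weight t a) + (t / (1 + t)) ^ M = 1"
proof (induction M)
  case (Suc M)
  have "geom_weight t M + (t / (1 + t)) ^ Suc M = (t / (1 + t)) ^ M"
    using assms by (simp add: geom_weight_def power_divide divide_simps) (simp add: algebra_simps)
  with Suc show ?case by simp
qed simp

lemma sum_geom_weight_le: "t \<ge> 0 \<Longrightarrow> (\<Sum>a<M. geom_weight t a) \<le> 1"
  using sum_geom_weight [of t M] zero_le_power [of "t / (1 + t)" M]
  by (smt (verit) divide_nonneg_nonneg)

text \<open>The left side is the mean after all values above \<open>M\<close> are replaced by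
  \<open>M\<close>, which can only lower it.\<close>

lemma sum_geom_weight_mean:
  assumes "t \<ge> 0"
  shows "(\<Sum>a<M. geom_weight t a * a) + (t / (1 + t)) ^ M * M \<le> t"
proof -
  have "(\<Sum>a<M. geom_weight t a * a) + (t / (1 + t)) ^ M * M = t - t * (t / (1 + t)) ^ M"
  proof (induction M)
    case (Suc M)
    have "geom_weight t M * M + (t / (1 + t)) ^ Suc M * Suc M
        = (t / (1 + t)) ^ M * M + (t / (1 + t)) ^ Suc M"
      using assms by (simp add: geom_weight_def power_divide divide_simps) (simp add: algebra_simps)
    moreover have "t * (t / (1 + t)) ^ M - t * (t / (1 + t)) ^ Suc M = (t / (1 + t)) ^ Suc M"
      using assms by (simp add: divide_simps) (simp add: algebra_simps)
    ultimately show ?case using Suc by (simp add: algebra_simps)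
  qed simp
  then show ?thesis using assms by simp
qed

text \<open>The sum over all \<open>a\<close> is \<open>exp (- \<theta> * R)\<close> with
  \<open>R\<close> the Renyi entropy of order \<open>1 + \<theta>\<close>. So \<open>R\<close> is at
  least \<open>hfun t\<close> up to a factor that is close to 1 when \<open>\<theta>\<close> and
  \<open>\<theta> * ln (1 + 1 / t)\<close> are small.\<close>

lemma sum_geom_weight_powr_le:
  assumes "t \<ge> 0" "\<theta> > 0"
  shows "(\<Sum>a<M. geom_weight t a powr (1 + \<theta>))
     \<le> exp (- (\<theta> * (exp (- \<theta> * ln (1 + 1 / t)) / (1 + \<theta>) * hfun t)))"
proof (cases "t = 0")
  case True
  have "(\<Sum>a<M. geom_weight 0 a powr (1 + \<theta>)) = (\<Sum>a<M. if a = 0 then 1 else 0)"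
    by (intro sum.cong) (auto simp: geom_weight_def)
  also have "\<dots> \<le> (1::real)" by simp
  finally show ?thesis using True by (simp add: hfun_def)
next
  case False
  with assms have t: "t > 0" by simp
  define r where "r = (t / (1 + t)) powr \<theta>"
  define y where "y = \<theta> * ln (1 + 1 / t)"
  have "ln (t / (1 + t)) = - ln (1 + 1 / t)"
    using t by (subst ln_inverse [symmetric]) (auto simp: field_simps)
  then have r_exp: "r = exp (- y)"
    using t by (simp add: r_def y_def powr_def)
  have y: "y \<ge> 0" using t assms by (simp add: y_def)
  have ty: "t * y \<le> \<theta>"
    using mult_left_mono [OF mult_ln_one_plus_inverse_le [of t], of \<theta>] t assms
    by (simp add: y_def mult_ac)
  have r01: "0 < r" "r \<le> 1" using y by (auto simp: r_exp)
  have r_lower: "1 - r \<ge> y * exp (- y)"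
    using mult_right_mono [OF exp_ge_add_one_self [of y], of "exp (- y)"]
    by (simp add: r_exp algebra_simps flip: exp_add)
  \<comment> \<open>The full series equals \<open>1 / ((1 + t) powr \<theta> * (1 + z))\<close>. Its
    negative logarithm \<open>\<theta> * ln (1 + t) + ln (1 + z)\<close> is compared term by term
    with the two summands of \<open>hfun_altdef\<close>.\<close>
  define z where "z = t * (1 - r)"
  have z0: "z \<ge> 0" using t r01 by (simp add: z_def)
  have "1 - r \<le> y" using exp_ge_add_one_self [of "- y"] by (simp add: r_exp)
  then have z\<theta>: "z \<le> \<theta>" using mult_left_mono [of "1 - r" y t] t ty unfolding z_def by linarith
  have "y * exp (- y) * t / (1 + \<theta>) \<le> z / (1 + \<theta>)"
    using r_lower t assms by (intro divide_right_mono) (auto simp: z_def mult.commute)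
  also have "\<dots> \<le> z / (1 + z)"
    using z0 z\<theta> by (intro divide_left_mono) auto
  also have "\<dots> \<le> ln (1 + z)"
    using ln_add1_ge [OF z0] by (simp add: add.commute)
  finally have lnz: "y * exp (- y) * t / (1 + \<theta>) \<le> ln (1 + z)" .
  have "exp (- y) / (1 + \<theta>) \<le> 1 / 1"
    using y assms by (intro frac_le) auto
  then have "\<theta> * ln (1 + t) * (exp (- y) / (1 + \<theta>)) \<le> \<theta> * ln (1 + t)"
    using assms t by (intro mult_left_le) auto
  with lnz have main: "\<theta> * (exp (- y) / (1 + \<theta>) * hfun t) \<le> \<theta> * ln (1 + t) + ln (1 + z)"
    using t by (simp add: hfun_altdef y_def algebra_simps add_divide_distrib)
  have powr_w: "geom_weight t a powr (1 + \<theta>)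
      = (t / (1 + t) * r) ^ a / ((1 + t) * (1 + t) powr \<theta>)" for a
  proof -
    have "geom_weight t a = (t / (1 + t)) ^ a / (1 + t)"
      by (simp add: geom_weight_def power_divide)
    moreover have "((t / (1 + t)) ^ a) powr \<theta> = r ^ a"
      using t by (simp add: r_def powr_realpow [symmetric] powr_powr mult.commute)
    ultimately have "geom_weight t a powr (1 + \<theta>)
        = (t / (1 + t)) ^ a * r ^ a / ((1 + t) * (1 + t) powr \<theta>)"
      using t by (simp add: powr_add powr_divide)
    then show ?thesis by (simp only: power_mult_distrib)
  qed
  define x where "x = t / (1 + t) * r"
  have "t / (1 + t) < 1" using t by simp
  then have x: "0 < x" "x < 1"
    using t r01 mult_le_one [of "t / (1 + t)" r] mult_less_le_imp_less [of "t / (1 + t)" 1 r 1]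
    by (auto simp: x_def)
  have x1: "(1 + t) * (1 - x) = 1 + z"
    using t by (simp add: x_def z_def field_simps)
  have "(\<Sum>a<M. x ^ a) \<le> 1 / (1 - x)"
    using x by (simp add: sum_gp_strict divide_right_mono)
  then have "(\<Sum>a<M. geom_weight t a powr (1 + \<theta>)) \<le> 1 / (1 - x) / ((1 + t) * (1 + t) powr \<theta>)"
    using t unfolding powr_w x_def [symmetric] sum_divide_distrib [symmetric]
    by (intro divide_right_mono) auto
  also have "\<dots> = 1 / ((1 + t) powr \<theta> * (1 + z))"
    by (simp add: x1 [symmetric] mult_ac)
  also have "\<dots> = exp (- (\<theta> * ln (1 + t) + ln (1 + z)))"
  proof -
    have "exp (\<theta> * ln (1 + t) + ln (1 + z)) = (1 + t) powr \<theta> * (1 + z)"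
      using t z0 by (simp add: exp_add powr_def)
    then show ?thesis by (simp add: exp_minus inverse_eq_divide del: minus_add_distrib)
  qed
  also have "\<dots> \<le> exp (- (\<theta> * (exp (- y) / (1 + \<theta>) * hfun t)))"
    using main by simp
  finally show ?thesis by (simp add: y_def)
qed

section \<open>Gibbs' inequality for finite sets of integer vectors\<close>

lemma sum_prod_le_prod_sum:
  fixes u :: "'a \<Rightarrow> nat \<Rightarrow> real" and c :: "'b \<Rightarrow> 'a \<Rightarrow> nat"
  assumes "finite I" "inj_on (\<lambda>x. restrict (c x) I) L"
    and "\<And>x e. x \<in> L \<Longrightarrow> e \<in> I \<Longrightarrow> c x e < M"
    and "\<And>e a. e \<in> I \<Longrightarrow> u e a \<ge> 0"
  shows "(\<Sum>x\<in>L. \<Prod>e\<in>I. u e (c x e)) \<le> (\<Prod>e\<in>I. \<Sum>a<M. u e a)"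
proof -
  have "(\<Sum>x\<in>L. \<Prod>e\<in>I. u e (c x e)) = (\<Sum>x\<in>L. \<Prod>e\<in>I. u e (restrict (c x) I e))"
    by (intro sum.cong prod.cong) auto
  also have "\<dots> = (\<Sum>g\<in>(\<lambda>x. restrict (c x) I) ` L. \<Prod>e\<in>I. u e (g e))"
    using assms(2) by (simp add: sum.reindex)
  \<comment> \<open>By injectivity the sum over \<open>L\<close> is part of the sum over the whole
    box, which factorises.\<close>
  also have "\<dots> \<le> (\<Sum>g\<in>I \<rightarrow>\<^sub>E {..<M}. \<Prod>e\<in>I. u e (g e))"
    using assms by (intro sum_mono2 finite_PiE prod_nonneg) auto
  also have "\<dots> = (\<Prod>e\<in>I. \<Sum>a<M. u e a)"
    using assms(1) by (subst prod_sum_PiE) auto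
  finally show ?thesis .
qed

text \<open>Gibbs' inequality for the uniform law on \<open>L\<close> against the product
  \<open>q\<close> of geometric laws with the same means. Since \<open>ln (q x)\<close> is affine in
  the coordinates, the cross entropy depends only on the means and is the sum of the
  \<open>hfun\<close>.\<close>

lemma ln_card_le_sum_hfun:
  fixes c :: "'b \<Rightarrow> 'a \<Rightarrow> nat"
  assumes I: "finite I" and L: "finite L" "L \<noteq> {}"
    and inj: "inj_on (\<lambda>x. restrict (c x) I) L"
  shows "ln (card L) \<le> (\<Sum>e\<in>I. hfun ((\<Sum>x\<in>L. real (c x e)) / card L))"
proof -
  define m where "m e = (\<Sum>x\<in>L. real (c x e)) / card L" for e
  define q where "q x = (\<Prod>e\<in>I. geom_weight (m e) (c x e))" for x
  define M where "M = Suc (\<Sum>x\<in>L. \<Sum>e\<in>I. c x e)"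
  define K where "K = real (card L)"
  have K: "K > 0" using L by (simp add: K_def card_gt_0_iff)
  have m0: "m e \<ge> 0" for e by (simp add: m_def sum_nonneg)
  have sum_c: "(\<Sum>x\<in>L. real (c x e)) = K * m e" for e
    using K by (simp add: m_def K_def)
  \<comment> \<open>A coordinate of mean 0 vanishes on all of \<open>L\<close>; this keeps
    \<open>q\<close> positive there.\<close>
  have c0: "c x e = 0" if "m e = 0" "x \<in> L" for x e
    using sum_c [of e] that L by (simp add: sum_nonneg_eq_0_iff)
  have M: "c x e < M" if "x \<in> L" "e \<in> I" for x e
  proof -
    have "c x e \<le> (\<Sum>e\<in>I. c x e)" using I that by (intro member_le_sum) auto
    also have "\<dots> \<le> (\<Sum>x\<in>L. \<Sum>e\<in>I. c x e)" using L that by (intro member_le_sum) auto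
    finally show ?thesis by (simp add: M_def)
  qed
  have "(\<Sum>x\<in>L. q x) \<le> (\<Prod>e\<in>I. \<Sum>a<M. geom_weight (m e) a)"
    unfolding q_def using I inj M m0 by (intro sum_prod_le_prod_sum) (auto intro: geom_weight_nonneg)
  also have "\<dots> \<le> 1"
    using m0 by (intro prod_le_1) (auto intro: sum_geom_weight_le sum_nonneg geom_weight_nonneg)
  finally have q1: "(\<Sum>x\<in>L. q x) \<le> 1" .
  have w_pos: "geom_weight (m e) (c x e) > 0" if "x \<in> L" for x e
    using m0 [of e] c0 [OF _ that, of e] by (cases "m e = 0") (auto simp: geom_weight_def)
  have q_pos: "q x > 0" if "x \<in> L" for x
    using w_pos [OF that] by (simp add: q_def prod_pos)
  have ln_w: "ln (geom_weight (m e) (c x e)) = c x e * ln (m e) - (c x e + 1) * ln (1 + m e)"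
    if "x \<in> L" for x e
  proof (cases "m e = 0")
    case False
    then have m: "m e > 0" "1 + m e > 0" using m0 [of e] by auto
    then have "ln (geom_weight (m e) (c x e)) = ln (m e ^ c x e) - ln ((1 + m e) ^ Suc (c x e))"
      by (simp add: geom_weight_def ln_div del: power_Suc)
    with m show ?thesis by (simp add: ln_realpow del: power_Suc)
  qed (use c0 that in \<open>simp add: geom_weight_def\<close>)
  have "(\<Sum>x\<in>L. ln (q x)) = (\<Sum>x\<in>L. \<Sum>e\<in>I. c x e * ln (m e) - (c x e + 1) * ln (1 + m e))"
  proof (intro sum.cong refl)
    fix x assume x: "x \<in> L"
    have "geom_weight (m e) (c x e) \<noteq> 0" for e
      using w_pos [OF x, of e] by simp
    then show "ln (q x) = (\<Sum>e\<in>I. c x e * ln (m e) - (c x e + 1) * ln (1 + m e))"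
      unfolding q_def using I ln_w [OF x] by (subst ln_prod) auto
  qed
  also have "\<dots> = (\<Sum>e\<in>I. \<Sum>x\<in>L. c x e * ln (m e) - (c x e + 1) * ln (1 + m e))"
    by (rule sum.swap)
  also have "\<dots> = (\<Sum>e\<in>I. - (K * hfun (m e)))"
  proof (intro sum.cong refl)
    fix e
    have "(\<Sum>x\<in>L. c x e * ln (m e) - (c x e + 1) * ln (1 + m e))
        = (\<Sum>x\<in>L. real (c x e)) * ln (m e) - ((\<Sum>x\<in>L. real (c x e)) + K) * ln (1 + m e)"
      by (simp add: sum_subtractf sum_distrib_right [symmetric] sum.distrib K_def)
    also have "\<dots> = - (K * hfun (m e))"
      by (simp add: sum_c hfun_def algebra_simps)
    finally show "(\<Sum>x\<in>L. c x e * ln (m e) - (c x e + 1) * ln (1 + m e)) = - (K * hfun (m e))" .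
  qed
  finally have 1: "(\<Sum>x\<in>L. ln (q x)) = - (K * (\<Sum>e\<in>I. hfun (m e)))"
    by (simp add: sum_negf sum_distrib_left)
  \<comment> \<open>\<open>ln y \<le> y - 1\<close> at \<open>y = K * q x\<close>, the ratio of
    \<open>q\<close> to the uniform law.\<close>
  have "(\<Sum>x\<in>L. ln (q x)) \<le> (\<Sum>x\<in>L. K * q x - 1 - ln K)"
  proof (intro sum_mono)
    fix x assume "x \<in> L"
    then show "ln (q x) \<le> K * q x - 1 - ln K"
      using ln_le_minus_one [of "K * q x"] q_pos [of x] K by (simp add: ln_mult)
  qed
  also have "\<dots> = K * (\<Sum>x\<in>L. q x) - K - K * ln K"
    by (simp add: sum_subtractf sum_distrib_left K_def)
  also have "\<dots> \<le> - (K * ln K)" using q1 K by (simp add: mult_left_le)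
  finally have "K * ln K \<le> K * (\<Sum>e\<in>I. hfun (m e))" using 1 by simp
  with K show ?thesis by (simp add: K_def m_def)
qed

subsection \<open>Counting integer points of packing polytopes\<close>

lemma sum_PiE_insert:
  fixes F :: "('a \<Rightarrow> nat) \<Rightarrow> real"
  assumes "finite I" "i \<notin> I"
  shows "(\<Sum>x\<in>insert i I \<rightarrow>\<^sub>E {..M}. F x) = (\<Sum>a\<le>M. \<Sum>x\<in>I \<rightarrow>\<^sub>E {..M}. F (x(i := a)))"
proof -
  have "(\<Sum>x\<in>insert i I \<rightarrow>\<^sub>E {..M}. F x)
      = (\<Sum>x\<in>(\<lambda>(y, g). g(i := y)) ` ({..M} \<times> (I \<rightarrow>\<^sub>E {..M})). F x)"
    by (simp add: PiE_insert_eq)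
  also have "\<dots> = (\<Sum>(a, x)\<in>{..M} \<times> (I \<rightarrow>\<^sub>E {..M}). F (x(i := a)))"
    using assms inj_combinator [of i I "\<lambda>_. {..M}"]
    by (subst sum.reindex) (auto simp: case_prod_unfold)
  finally show ?thesis by (simp add: sum.cartesian_product)
qed

text \<open>For two independent copies \<open>a\<close>, \<open>b\<close> the product of the
  differences of \<open>F\<close> and of \<open>G\<close> is nonnegative, and its mean is twice the
  covariance.\<close>

lemma weighted_Chebyshev_sum:
  fixes v F G :: "nat \<Rightarrow> real"
  assumes "\<And>a. v a \<ge> 0" "(\<Sum>a\<le>M. v a) = 1"
    and F: "\<And>a b. a \<le> b \<Longrightarrow> b \<le> M \<Longrightarrow> F b \<le> F a"
    and G: "\<And>a b. a \<le> b \<Longrightarrow> b \<le> M \<Longrightarrow> G b \<le> G a"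
  shows "(\<Sum>a\<le>M. v a * F a) * (\<Sum>a\<le>M. v a * G a) \<le> (\<Sum>a\<le>M. v a * (F a * G a))"
proof -
  have "0 \<le> (\<Sum>a\<le>M. \<Sum>b\<le>M. v a * v b * ((F a - F b) * (G a - G b)))"
  proof (intro sum_nonneg)
    fix a b assume ab: "a \<in> {..M}" "b \<in> {..M}"
    have "(F a - F b) * (G a - G b) \<ge> 0"
    proof (cases "a \<le> b")
      case True
      then show ?thesis using F [of a b] G [of a b] ab by simp
    next
      case False
      then show ?thesis using F [of b a] G [of b a] ab by (simp add: mult_nonpos_nonpos)
    qed
    then show "0 \<le> v a * v b * ((F a - F b) * (G a - G b))"
      using assms(1) by simp
  qed
  also have "\<dots> = (\<Sum>a\<le>M. \<Sum>b\<le>M. (v a * (F a * G a)) * v b + v a * (v b * (F b * G b))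
      - (v a * F a) * (v b * G b) - (v a * G a) * (v b * F b))"
    by (simp add: algebra_simps)
  also have "\<dots> = (\<Sum>a\<le>M. v a * (F a * G a)) * (\<Sum>b\<le>M. v b)
      + (\<Sum>a\<le>M. v a) * (\<Sum>b\<le>M. v b * (F b * G b))
      - (\<Sum>a\<le>M. v a * F a) * (\<Sum>b\<le>M. v b * G b) - (\<Sum>a\<le>M. v a * G a) * (\<Sum>b\<le>M. v b * F b)"
    by (simp only: sum_product sum_subtractf sum.distrib)
  finally show ?thesis
    using assms(2) by (simp add: mult.commute)
qed

text \<open>Induction on the coordinates. With the new coordinate fixed the induction hypothesis
  applies; the conditional means are antitone in that coordinate, so the one-dimensional case
  combines them.\<close>

lemma Harris_inequality:
  fixes v :: "'a \<Rightarrow> nat \<Rightarrow> real" and F G :: "('a \<Rightarrow> nat) \<Rightarrow> real"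
  assumes "finite I" "\<And>e a. v e a \<ge> 0" "\<And>e. e \<in> I \<Longrightarrow> (\<Sum>a\<le>M. v e a) = 1"
    and "\<And>x y. x \<in> I \<rightarrow>\<^sub>E {..M} \<Longrightarrow> y \<in> I \<rightarrow>\<^sub>E {..M} \<Longrightarrow> (\<And>e. e \<in> I \<Longrightarrow> x e \<le> y e) \<Longrightarrow> F y \<le> F x"
    and "\<And>x y. x \<in> I \<rightarrow>\<^sub>E {..M} \<Longrightarrow> y \<in> I \<rightarrow>\<^sub>E {..M} \<Longrightarrow> (\<And>e. e \<in> I \<Longrightarrow> x e \<le> y e) \<Longrightarrow> G y \<le> G x"
  shows "(\<Sum>x\<in>I \<rightarrow>\<^sub>E {..M}. (\<Prod>e\<in>I. v e (x e)) * F x) * (\<Sum>x\<in>I \<rightarrow>\<^sub>E {..M}. (\<Prod>e\<in>I. v e (x e)) * G x)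
    \<le> (\<Sum>x\<in>I \<rightarrow>\<^sub>E {..M}. (\<Prod>e\<in>I. v e (x e)) * (F x * G x))"
  using assms
proof (induction I arbitrary: F G rule: finite_induct)
  case empty
  then show ?case by simp
next
  case (insert i I)
  define w where "w x = (\<Prod>e\<in>I. v e (x e))" for x
  \<comment> \<open>Average over the old coordinates, the new one being held fixed inside
    \<open>H\<close>.\<close>
  define E where "E H = (\<Sum>x\<in>I \<rightarrow>\<^sub>E {..M}. w x * H x)" for H
  have w0: "w x \<ge> 0" for x using insert.prems(1) by (simp add: w_def prod_nonneg)
  have expand: "(\<Sum>x\<in>insert i I \<rightarrow>\<^sub>E {..M}. (\<Prod>e\<in>insert i I. v e (x e)) * H x)
      = (\<Sum>a\<le>M. v i a * E (\<lambda>x. H (x(i := a))))" for H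
  proof -
    have "(\<Prod>e\<in>insert i I. v e ((x(i := a)) e)) = v i a * w x" for x a
    proof -
      have "(\<Prod>e\<in>I. v e ((x(i := a)) e)) = w x"
        unfolding w_def using insert.hyps by (intro prod.cong) auto
      then show ?thesis using insert.hyps by simp
    qed
    then show ?thesis
      using insert.hyps by (subst sum_PiE_insert) 
        (simp_all add: E_def sum_distrib_left mult.assoc del: fun_upd_apply)
  qed
  have upd: "x(i := a) \<in> insert i I \<rightarrow>\<^sub>E {..M}" if "x \<in> I \<rightarrow>\<^sub>E {..M}" "a \<le> M" for x a
    using that by (auto simp: PiE_def extensional_def)
  have antimono: "E (\<lambda>x. H (x(i := b))) \<le> E (\<lambda>x. H (x(i := a)))"
    if H: "\<And>x y. x \<in> insert i I \<rightarrow>\<^sub>E {..M} \<Longrightarrow> y \<in> insert i I \<rightarrow>\<^sub>E {..M} \<Longrightarrow>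
         (\<And>e. e \<in> insert i I \<Longrightarrow> x e \<le> y e) \<Longrightarrow> H y \<le> H x"
      and ab: "a \<le> b" "b \<le> M" for H :: "('a \<Rightarrow> nat) \<Rightarrow> real" and a b
    unfolding E_def using ab w0
    by (intro sum_mono mult_left_mono H upd) auto
  have IH: "E (\<lambda>x. F (x(i := a))) * E (\<lambda>x. G (x(i := a))) \<le> E (\<lambda>x. F (x(i := a)) * G (x(i := a)))"
    if a: "a \<le> M" for a
    unfolding E_def w_def
    using a insert.prems(1,2)
    by (intro insert.IH insert.prems(3,4) upd) auto
  have "(\<Sum>a\<le>M. v i a * E (\<lambda>x. F (x(i := a)))) * (\<Sum>a\<le>M. v i a * E (\<lambda>x. G (x(i := a))))
     \<le> (\<Sum>a\<le>M. v i a * (E (\<lambda>x. F (x(i := a))) * E (\<lambda>x. G (x(i := a)))))"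
    using insert.prems by (intro weighted_Chebyshev_sum antimono) auto
  also have "\<dots> \<le> (\<Sum>a\<le>M. v i a * E (\<lambda>x. F (x(i := a)) * G (x(i := a))))"
    using insert.prems(1) IH by (intro sum_mono mult_left_mono) auto
  finally show ?case by (simp only: expand)
qed

text \<open>Nonnegativity keeps products of antitone functions antitone, so the two-function case
  can be iterated.\<close>

lemma Harris_inequality_prod:
  fixes v :: "'a \<Rightarrow> nat \<Rightarrow> real" and F :: "'c \<Rightarrow> ('a \<Rightarrow> nat) \<Rightarrow> real"
  assumes I: "finite I" and v: "\<And>e a. v e a \<ge> 0" "\<And>e. e \<in> I \<Longrightarrow> (\<Sum>a\<le>M. v e a) = 1"
    and "finite C" "\<And>c x. c \<in> C \<Longrightarrow> F c x \<ge> 0"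
    and "\<And>c x y. c \<in> C \<Longrightarrow> x \<in> I \<rightarrow>\<^sub>E {..M} \<Longrightarrow> y \<in> I \<rightarrow>\<^sub>E {..M} \<Longrightarrow>
      (\<And>e. e \<in> I \<Longrightarrow> x e \<le> y e) \<Longrightarrow> F c y \<le> F c x"
  shows "(\<Prod>c\<in>C. \<Sum>x\<in>I \<rightarrow>\<^sub>E {..M}. (\<Prod>e\<in>I. v e (x e)) * F c x)
    \<le> (\<Sum>x\<in>I \<rightarrow>\<^sub>E {..M}. (\<Prod>e\<in>I. v e (x e)) * (\<Prod>c\<in>C. F c x))"
  using assms(4-)
proof (induction C rule: finite_induct)
  case empty
  have "(\<Sum>x\<in>I \<rightarrow>\<^sub>E {..M}. \<Prod>e\<in>I. v e (x e)) = (\<Prod>e\<in>I. \<Sum>a\<le>M. v e a)"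
    using I by (subst prod_sum_PiE) auto
  then show ?case using v(2) by simp
next
  case (insert c C)
  have "(\<Prod>c\<in>insert c C. \<Sum>x\<in>I \<rightarrow>\<^sub>E {..M}. (\<Prod>e\<in>I. v e (x e)) * F c x)
     \<le> (\<Sum>x\<in>I \<rightarrow>\<^sub>E {..M}. (\<Prod>e\<in>I. v e (x e)) * F c x) *
       (\<Sum>x\<in>I \<rightarrow>\<^sub>E {..M}. (\<Prod>e\<in>I. v e (x e)) * (\<Prod>c\<in>C. F c x))"
    using insert v by (simp add: mult_left_mono sum_nonneg prod_nonneg)
  also have "\<dots> \<le> (\<Sum>x\<in>I \<rightarrow>\<^sub>E {..M}. (\<Prod>e\<in>I. v e (x e)) * (F c x * (\<Prod>c\<in>C. F c x)))"
    using insert.prems I v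
    by (intro Harris_inequality) (auto intro!: prod_mono)
  finally show ?case using insert.hyps by simp
qed

section \<open>From the probability of packings to their number\<close>

lemma sum_PiE_marginal:
  fixes v :: "'a \<Rightarrow> nat \<Rightarrow> real"
  assumes I: "finite I" "\<And>e. e \<in> I \<Longrightarrow> (\<Sum>a\<le>M. v e a) = 1" and i: "i \<in> I"
  shows "(\<Sum>x\<in>I \<rightarrow>\<^sub>E {..M}. (\<Prod>e\<in>I. v e (x e)) * f (x i)) = (\<Sum>a\<le>M. v i a * f a)"
proof -
  \<comment> \<open>Absorb \<open>f\<close> into the factor at \<open>i\<close>; every other factor
    sums to 1.\<close>
  define u where "u e a = v e a * (if e = i then f a else 1)" for e a
  have "(\<Sum>x\<in>I \<rightarrow>\<^sub>E {..M}. (\<Prod>e\<in>I. v e (x e)) * f (x i)) = (\<Sum>x\<in>I \<rightarrow>\<^sub>E {..M}. \<Prod>e\<in>I. u e (x e))"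
    using I i by (simp add: u_def prod.distrib prod.delta')
  also have "\<dots> = (\<Prod>e\<in>I. \<Sum>a\<le>M. u e a)"
    using I by (subst prod_sum_PiE) auto
  also have "\<dots> = (\<Sum>a\<le>M. u i a) * (\<Prod>e\<in>I - {i}. \<Sum>a\<le>M. u e a)"
    using I i by (intro prod.remove)
  also have "(\<Prod>e\<in>I - {i}. \<Sum>a\<le>M. u e a) = 1"
    using I by (intro prod.neutral) (auto simp: u_def)
  finally show ?thesis by (simp add: u_def)
qed

text \<open>Hoelder's inequality in logarithmic form: mass \<open>P\<close> on few points forces a
  large power sum, so the bound \<open>exp Q\<close> on that sum forces many points.\<close>

lemma powr_sum_le_card_mult_sum_powr:
  fixes q :: "'b \<Rightarrow> real"
  assumes L: "finite L" and q: "\<And>x. x \<in> L \<Longrightarrow> q x \<ge> 0" and P: "0 < P" "P \<le> (\<Sum>x\<in>L. q x)"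
    and "\<theta> > 0" and Q: "(\<Sum>x\<in>L. q x powr (1 + \<theta>)) \<le> exp Q"
  shows "(1 + \<theta>) * ln P \<le> \<theta> * ln (card L) + Q"
proof -
  define S where "S = (\<Sum>x\<in>L. q x)"
  define K where "K = real (card L)"
  have S: "S > 0" using P by (simp add: S_def)
  then have "L \<noteq> {}" by (auto simp: S_def)
  then have K: "K > 0" using L by (simp add: K_def card_gt_0_iff)
  \<comment> \<open>Bernoulli's inequality for real exponents, from
    \<open>z powr (1 + \<theta>) = z * exp (\<theta> * ln z)\<close>.\<close>
  have Bern: "1 + (1 + \<theta>) * (z - 1) \<le> z powr (1 + \<theta>)" if "z \<ge> 0" for z
  proof (cases "z = 0")
    case False
    with that have z: "z > 0" by simp
    have "z - 1 \<le> z * ln z"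
    proof -
      have "1 - 1 / z \<le> ln z"
        using ln_le_minus_one [of "1 / z"] z by (simp add: ln_div)
      from mult_left_mono [OF this, of z] z show ?thesis by (simp add: algebra_simps)
    qed
    then have "\<theta> * (z - 1) \<le> z * (\<theta> * ln z)"
      using mult_left_mono [of "z - 1" "z * ln z" \<theta>] \<open>\<theta> > 0\<close> by (simp add: algebra_simps)
    moreover have "z * (1 + \<theta> * ln z) \<le> z * exp (\<theta> * ln z)"
      using z exp_ge_add_one_self by (intro mult_left_mono) auto
    moreover have "z powr (1 + \<theta>) = z * exp (\<theta> * ln z)"
      using z by (simp add: powr_add) (simp add: powr_def)
    ultimately show ?thesis
      unfolding distrib_left distrib_right right_diff_distrib by linarith
  qed (use \<open>\<theta> > 0\<close> in simp)
  have scale: "1 + (1 + \<theta>) * (K / S * q x - 1) \<le> (K / S) powr (1 + \<theta>) * q x powr (1 + \<theta>)"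
    if "x \<in> L" for x
    using Bern [of "K / S * q x"] K S q [OF that] by (simp add: powr_mult powr_divide)
  \<comment> \<open>The scale \<open>K / S\<close> gives the arguments mean 1 over \<open>L\<close>,
    so the linear terms of Bernoulli's inequality cancel.\<close>
  have "(\<Sum>x\<in>L. K / S * q x) = K"
    unfolding sum_distrib_left [symmetric] using S by (simp add: S_def)
  then have "K = (\<Sum>x\<in>L. 1 + (1 + \<theta>) * (K / S * q x - 1))"
    unfolding sum.distrib sum_distrib_left [symmetric] sum_subtractf by (simp add: K_def)
  also have "\<dots> \<le> (K / S) powr (1 + \<theta>) * (\<Sum>x\<in>L. q x powr (1 + \<theta>))"
    unfolding sum_distrib_left by (intro sum_mono scale)
  also have "\<dots> \<le> (K / S) powr (1 + \<theta>) * exp Q"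
    using Q by (intro mult_left_mono) auto
  finally have "ln K \<le> ln ((K / S) powr (1 + \<theta>) * exp Q)"
    using K by (intro ln_mono) auto
  also have "\<dots> = (1 + \<theta>) * (ln K - ln S) + Q"
    using K S by (simp add: ln_mult ln_powr ln_div)
  finally have "(1 + \<theta>) * ln S \<le> \<theta> * ln K + Q"
    by (simp add: algebra_simps)
  moreover have "(1 + \<theta>) * ln P \<le> (1 + \<theta>) * ln S"
    using P \<open>\<theta> > 0\<close> by (intro mult_left_mono ln_mono) (auto simp: S_def)
  ultimately show ?thesis by (simp add: K_def)
qed

text \<open>\<open>extensional\<close> makes a packing determined by its coordinates in
  \<open>I\<close>.\<close>

definition packings :: "'a set \<Rightarrow> 'c set \<Rightarrow> ('c \<Rightarrow> 'a set) \<Rightarrow> ('c \<Rightarrow> nat) \<Rightarrow> ('a \<Rightarrow> nat) set" where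
  "packings I C A S = {x \<in> extensional I. \<forall>c\<in>C. (\<Sum>e\<in>A c. x e) \<le> S c}"

lemma packing_le:
  assumes "x \<in> packings I C A S" "c \<in> C" "e \<in> A c" "finite (A c)"
  shows "x e \<le> S c"
proof -
  have "x e \<le> (\<Sum>e\<in>A c. x e)" using assms by (intro member_le_sum) auto
  also have "\<dots> \<le> S c" using assms by (simp add: packings_def)
  finally show ?thesis .
qed

text \<open>Independent geometric coordinates of mean \<open>t e\<close> form a packing with
  probability at least \<open>\<epsilon> ^ card C\<close>; Hoelder's inequality and the Renyi bound
  turn this into a count. Every coordinate lies in some constraint, which bounds the
  packings.\<close>

lemma ln_card_packings_ge:
  fixes t :: "'a \<Rightarrow> real" and S :: "'c \<Rightarrow> nat" and \<epsilon> \<theta> :: real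
  assumes I: "finite I" and C: "finite C"
    and A: "\<And>c. c \<in> C \<Longrightarrow> A c \<subseteq> I" "\<And>e. e \<in> I \<Longrightarrow> \<exists>c\<in>C. e \<in> A c"
    and S: "\<And>c. c \<in> C \<Longrightarrow> S c > 0"
    and t: "\<And>e. e \<in> I \<Longrightarrow> t e \<ge> 0" "\<And>c. c \<in> C \<Longrightarrow> (\<Sum>e\<in>A c. t e) \<le> (1 - \<epsilon>) * S c"
    and \<epsilon>: "0 < \<epsilon>" and \<theta>: "\<theta> > 0"
  shows "(1 + \<theta>) * card C * ln \<epsilon>
     + \<theta> * (\<Sum>e\<in>I. exp (- \<theta> * ln (1 + 1 / t e)) / (1 + \<theta>) * hfun (t e))
     \<le> \<theta> * ln (card (packings I C A S))"
proof -
  define L where "L = packings I C A S"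
  \<comment> \<open>Exceeds every capacity, so entries of packings stay below
    \<open>M\<close>.\<close>
  define M where "M = Suc (\<Sum>c\<in>C. S c)"
  define \<tau> where "\<tau> e = (if e \<in> I then t e else 0)" for e
  \<comment> \<open>The tail of the geometric law is lumped at \<open>M\<close>, a value that no packing takes.\<close>
  define v where "v e a = (if a < M then geom_weight (\<tau> e) a else (\<tau> e / (1 + \<tau> e)) ^ M)" for e a
  define w where "w x = (\<Prod>e\<in>I. v e (x e))" for x
  define F where "F c x = (of_bool ((\<Sum>e\<in>A c. x e) \<le> S c) :: real)" for c and x :: "'a \<Rightarrow> nat"
  have \<tau>: "\<tau> e \<ge> 0" for e using t by (simp add: \<tau>_def)
  have v0: "v e a \<ge> 0" for e a using \<tau> by (simp add: v_def geom_weight_nonneg)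
  have sum_M: "(\<Sum>a\<le>M. v e a * f a) = (\<Sum>a<M. geom_weight (\<tau> e) a * f a) + (\<tau> e / (1 + \<tau> e)) ^ M * f M"
    for e f
    by (simp add: v_def flip: lessThan_Suc_atMost)
  have v1: "(\<Sum>a\<le>M. v e a) = 1" for e
    using sum_M [of e "\<lambda>_. 1"] sum_geom_weight [OF \<tau>] by simp
  have v_mean: "(\<Sum>a\<le>M. v e a * real a) \<le> \<tau> e" for e
    using sum_M [of e real] sum_geom_weight_mean [OF \<tau>] by simp
  have w0: "w x \<ge> 0" for x using v0 by (simp add: w_def prod_nonneg)
  have w1: "(\<Sum>x\<in>I \<rightarrow>\<^sub>E {..M}. w x) = 1"
    unfolding w_def using I v1 by (subst prod_sum_PiE [symmetric]) auto
  have fA: "finite (A c)" if "c \<in> C" for c using A I that finite_subset by blast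
  have LM: "x e < M" if x: "x \<in> L" and e: "e \<in> I" for x e
  proof -
    obtain c where c: "c \<in> C" "e \<in> A c" using A(2) [OF e] by blast
    have "x e \<le> S c" by (rule packing_le [OF x [unfolded L_def] c fA [OF c(1)]])
    also have "S c \<le> (\<Sum>c\<in>C. S c)" using C c by (intro member_le_sum) auto
    finally show ?thesis by (simp add: M_def)
  qed
  \<comment> \<open>Markov's inequality: average the pointwise bound
    \<open>1 - X / S \<le> of_bool (X \<le> S)\<close> for the load
    \<open>X \<ge> 0\<close>.\<close>
  have markov: "\<epsilon> \<le> (\<Sum>x\<in>I \<rightarrow>\<^sub>E {..M}. w x * F c x)" if c: "c \<in> C" for c
  proof -
    have "(\<Sum>x\<in>I \<rightarrow>\<^sub>E {..M}. w x * (\<Sum>e\<in>A c. real (x e)))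
        = (\<Sum>e\<in>A c. \<Sum>x\<in>I \<rightarrow>\<^sub>E {..M}. w x * real (x e))"
      by (simp add: sum_distrib_left) (rule sum.swap)
    also have "\<dots> = (\<Sum>e\<in>A c. \<Sum>a\<le>M. v e a * real a)"
      unfolding w_def using A(1) [OF c] I v1
      by (intro sum.cong refl sum_PiE_marginal [where f = real]) auto
    also have "\<dots> \<le> (\<Sum>e\<in>A c. t e)"
    proof (intro sum_mono)
      fix e assume "e \<in> A c"
      then show "(\<Sum>a\<le>M. v e a * real a) \<le> t e"
        using v_mean [of e] A(1) [OF c] by (auto simp: \<tau>_def)
    qed
    also have "\<dots> \<le> (1 - \<epsilon>) * S c" by (rule t(2) [OF c])
    finally have "(\<Sum>x\<in>I \<rightarrow>\<^sub>E {..M}. w x * (\<Sum>e\<in>A c. real (x e))) / S c \<le> 1 - \<epsilon>"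
      using S [OF c] by (simp add: divide_le_eq)
    moreover have "(\<Sum>x\<in>I \<rightarrow>\<^sub>E {..M}. w x * (1 - X x / S c))
        = 1 - (\<Sum>x\<in>I \<rightarrow>\<^sub>E {..M}. w x * X x) / S c" for X
      by (simp add: right_diff_distrib sum_subtractf w1 sum_divide_distrib)
    ultimately have "\<epsilon> \<le> (\<Sum>x\<in>I \<rightarrow>\<^sub>E {..M}. w x * (1 - (\<Sum>e\<in>A c. real (x e)) / S c))"
      by simp
    also have "\<dots> \<le> (\<Sum>x\<in>I \<rightarrow>\<^sub>E {..M}. w x * F c x)"
    proof (intro sum_mono mult_left_mono w0)
      fix x :: "'a \<Rightarrow> nat"
      show "1 - (\<Sum>e\<in>A c. real (x e)) / S c \<le> F c x"
        using S [OF c] by (auto simp: F_def sum_nonneg simp flip: of_nat_sum)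
    qed
    finally show ?thesis .
  qed
  have "\<epsilon> ^ card C = (\<Prod>c\<in>C. \<epsilon>)" by simp
  also have "\<dots> \<le> (\<Prod>c\<in>C. \<Sum>x\<in>I \<rightarrow>\<^sub>E {..M}. w x * F c x)"
    using markov \<epsilon> by (intro prod_mono) auto
  also have "\<dots> \<le> (\<Sum>x\<in>I \<rightarrow>\<^sub>E {..M}. w x * (\<Prod>c\<in>C. F c x))"
    unfolding w_def
  proof (rule Harris_inequality_prod)
    fix c and x y :: "'a \<Rightarrow> nat"
    assume c: "c \<in> C" and le: "\<And>e. e \<in> I \<Longrightarrow> x e \<le> y e"
    have "(\<Sum>e\<in>A c. x e) \<le> (\<Sum>e\<in>A c. y e)"
      using A(1) [OF c] le by (intro sum_mono) auto
    then show "F c y \<le> F c x" by (auto simp: F_def)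
  qed (use I C v0 v1 in \<open>auto simp: F_def\<close>)
  also have "\<dots> = (\<Sum>x\<in>L. w x)"
  proof -
    have F: "w x * (\<Prod>c\<in>C. F c x) = (if \<forall>c\<in>C. (\<Sum>e\<in>A c. x e) \<le> S c then w x else 0)" for x
      using C by (auto simp: F_def)
    moreover have "L = {x \<in> I \<rightarrow>\<^sub>E {..M}. \<forall>c\<in>C. (\<Sum>e\<in>A c. x e) \<le> S c}"
      using LM by (auto simp: L_def packings_def PiE_def less_imp_le)
    moreover have "finite (I \<rightarrow>\<^sub>E {..M})" using I by (intro finite_PiE) auto
    ultimately show ?thesis
      by (simp only: F sum.inter_filter)
  qed
  finally have P: "\<epsilon> ^ card C \<le> (\<Sum>x\<in>L. w x)" .
  have L_sub: "L \<subseteq> I \<rightarrow>\<^sub>E {..<M}" using LM by (auto simp: L_def packings_def PiE_def)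
  then have finL: "finite L" by (rule finite_subset) (use I in \<open>simp add: finite_PiE\<close>)
  define Q where "Q = - (\<theta> * (\<Sum>e\<in>I. exp (- \<theta> * ln (1 + 1 / t e)) / (1 + \<theta>) * hfun (t e)))"
  \<comment> \<open>No packing reaches the lumped value \<open>M\<close>, so on \<open>L\<close> the
    weights are purely geometric.\<close>
  have "(\<Sum>x\<in>L. w x powr (1 + \<theta>)) = (\<Sum>x\<in>L. \<Prod>e\<in>I. geom_weight (t e) (x e) powr (1 + \<theta>))"
  proof (intro sum.cong refl)
    fix x assume "x \<in> L"
    then have "w x = (\<Prod>e\<in>I. geom_weight (t e) (x e))"
      unfolding w_def using LM by (intro prod.cong) (auto simp: v_def \<tau>_def)
    then show "w x powr (1 + \<theta>) = (\<Prod>e\<in>I. geom_weight (t e) (x e) powr (1 + \<theta>))"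
      using t by (simp add: prod_powr_distrib geom_weight_nonneg)
  qed
  also have "\<dots> \<le> (\<Prod>e\<in>I. \<Sum>a<M. geom_weight (t e) a powr (1 + \<theta>))"
    using I LM by (intro sum_prod_le_prod_sum) (auto simp: inj_on_def L_def packings_def extensional_restrict)
  also have "\<dots> \<le> (\<Prod>e\<in>I. exp (- (\<theta> * (exp (- \<theta> * ln (1 + 1 / t e)) / (1 + \<theta>) * hfun (t e)))))"
    using t \<theta> by (intro prod_mono conjI sum_geom_weight_powr_le sum_nonneg) auto
  also have "\<dots> = exp Q"
    using I by (simp add: exp_sum [symmetric] Q_def sum_distrib_left sum_negf)
  finally have "(1 + \<theta>) * ln (\<epsilon> ^ card C) \<le> \<theta> * ln (card L) + Q"
    using P \<epsilon> \<theta> finL w0 by (intro powr_sum_le_card_mult_sum_powr [where q = w]) auto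
  then show ?thesis
    using \<epsilon> by (simp add: ln_realpow Q_def L_def mult.assoc)
qed

subsection \<open>Flows as packings\<close>

definition cut_flow :: "nat \<Rightarrow> (nat \<Rightarrow> nat \<Rightarrow> real) \<Rightarrow> nat \<Rightarrow> real" where
  "cut_flow n f i = (\<Sum>k\<le>i. \<Sum>j\<in>{i<..n}. f k j)"

lemma cut_flow_Suc:
  assumes "Suc i \<le> n"
  shows "cut_flow n f (Suc i)
    = cut_flow n f i + ((\<Sum>j\<in>{Suc i<..n}. f (Suc i) j) - (\<Sum>k<Suc i. f k (Suc i)))"
proof -
  have "{i<..n} = insert (Suc i) {Suc i<..n}" using assms by auto
  then show ?thesis
    by (simp add: cut_flow_def sum.distrib lessThan_Suc_atMost)
qed

lemma cut_flow_eq_sum_netflow: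
  assumes "i \<le> n"
  shows "cut_flow n f i = (\<Sum>l\<le>i. (\<Sum>j\<in>{l<..n}. f l j) - (\<Sum>k<l. f k l))"
  using assms
proof (induction i)
  case 0
  then show ?case by (simp add: cut_flow_def)
next
  case (Suc i)
  then show ?case by (simp add: cut_flow_Suc)
qed

text \<open>Summing the conservation laws up to \<open>i\<close> gives the cut equations;
  differences of consecutive cuts give them back.\<close>

lemma flow_polytope_iff_cut_flow:
  "f \<in> flow_polytope n M \<longleftrightarrow>
     (\<forall>i j. \<not> (i < j \<and> j \<le> n) \<longrightarrow> f i j = 0) \<and>
     (\<forall>i j. i < j \<and> j \<le> n \<longrightarrow> f i j \<ge> 0) \<and>
     (\<forall>i \<le> n. cut_flow n f i = of_int (\<Sum>l\<le>i. M l))"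
proof -
  have "(\<forall>i \<le> n. (\<Sum>j\<in>{i<..n}. f i j) - (\<Sum>k<i. f k i) = of_int (M i)) \<longleftrightarrow>
        (\<forall>i \<le> n. cut_flow n f i = of_int (\<Sum>l\<le>i. M l))" (is "?A \<longleftrightarrow> ?B")
  proof
    assume ?A
    then show ?B by (auto simp: cut_flow_eq_sum_netflow intro!: sum.cong)
  next
    assume B: ?B
    show ?A
    proof (intro allI impI)
      fix i assume i: "i \<le> n"
      show "(\<Sum>j\<in>{i<..n}. f i j) - (\<Sum>k<i. f k i) = of_int (M i)"
      proof (cases i)
        case 0
        then show ?thesis using B by (auto simp: cut_flow_def)
      next
        case (Suc l)
        then have "cut_flow n f (Suc l) - cut_flow n f l = of_int (M i)"
          using B i by simp
        then show ?thesis using Suc i by (simp add: cut_flow_Suc)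
      qed
    qed
  qed
  then show ?thesis by (auto simp: flow_polytope_def)
qed

lemma sum_netflow_vec:
  assumes "i \<le> n"
  shows "(\<Sum>l\<le>i. netflow_vec N n l) = (if i < n then \<Sum>l\<le>i. N l else 0)"
proof (cases "i < n")
  case False
  with assms have "i = n" by simp
  then have "{..i} = insert n {..<n}" by auto
  then show ?thesis using \<open>i = n\<close> by (simp add: netflow_vec_def)
qed (auto simp: netflow_vec_def intro!: sum.cong)

section \<open>Adjacent arcs as slack variables\<close>

definition arcs :: "nat \<Rightarrow> (nat \<times> nat) set" where
  "arcs n = {(k, j). k < j \<and> j \<le> n}"

definition skip_arcs :: "nat \<Rightarrow> (nat \<times> nat) set" where
  "skip_arcs n = {(k, j). k + 2 \<le> j \<and> j \<le> n}"

definition skip_arcs_across :: "nat \<Rightarrow> nat \<Rightarrow> (nat \<times> nat) set" where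
  "skip_arcs_across n i = {(k, j) \<in> skip_arcs n. k \<le> i \<and> i < j}"

lemma finite_arcs: "finite (arcs n)"
  by (rule finite_subset [of _ "{..n} \<times> {..n}"]) (auto simp: arcs_def)

lemma arcs_eq: "arcs n = skip_arcs n \<union> (\<lambda>i. (i, Suc i)) ` {..<n}"
  by (auto simp: arcs_def skip_arcs_def image_iff)

lemma finite_skip_arcs: "finite (skip_arcs n)"
  using finite_arcs [of n] by (simp add: arcs_eq)

lemma card_skip_arcs_le: "card (skip_arcs n) \<le> n * n"
proof -
  have "skip_arcs n \<subseteq> {..<n} \<times> {1..n}" by (auto simp: skip_arcs_def)
  then have "card (skip_arcs n) \<le> card ({..<n} \<times> {1..n})" by (intro card_mono) auto
  then show ?thesis by simp
qed

lemma finite_skip_arcs_across: "finite (skip_arcs_across n i)"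
  by (rule finite_subset [OF _ finite_skip_arcs [of n]]) (auto simp: skip_arcs_across_def)

text \<open>Each adjacent arc crosses exactly one cut, so it can serve as the slack of that cut
  equation.\<close>

lemma cut_flow_eq_across:
  assumes "i < n"
  shows "cut_flow n f i = f i (Suc i) + (\<Sum>(k, j)\<in>skip_arcs_across n i. f k j)"
proof -
  have "cut_flow n f i = (\<Sum>(k, j)\<in>{..i} \<times> {i<..n}. f k j)"
    by (simp add: cut_flow_def sum.cartesian_product)
  also have "{..i} \<times> {i<..n} = insert (i, Suc i) (skip_arcs_across n i)"
    using assms by (auto simp: skip_arcs_across_def skip_arcs_def)
  also have "(\<Sum>(k, j)\<in>\<dots>. f k j) = f i (Suc i) + (\<Sum>(k, j)\<in>skip_arcs_across n i. f k j)"
    by (subst sum.insert [OF finite_skip_arcs_across]) (auto simp: skip_arcs_across_def skip_arcs_def)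
  finally show ?thesis .
qed

text \<open>Real-valued \<open>x\<close> lets one map serve integer packings and the fractional flow
  that bounds the supremum from below.\<close>

definition flow_of_packing :: "nat \<Rightarrow> (nat \<Rightarrow> int) \<Rightarrow> (nat \<times> nat \<Rightarrow> real) \<Rightarrow> nat \<Rightarrow> nat \<Rightarrow> real" where
  "flow_of_packing n N x k j =
     (if (k, j) \<in> skip_arcs n then x (k, j)
      else if j = Suc k \<and> k < n then of_int (\<Sum>l\<le>k. N l) - (\<Sum>e\<in>skip_arcs_across n k. x e)
      else 0)"

text \<open>The cut equations hold by the choice of the slack, and \<open>le\<close> is its
  nonnegativity.\<close>

lemma flow_of_packing_in_polytope:
  assumes x: "\<And>e. e \<in> skip_arcs n \<Longrightarrow> x e \<ge> 0"
    and le: "\<And>i. i < n \<Longrightarrow> (\<Sum>e\<in>skip_arcs_across n i. x e) \<le> of_int (\<Sum>l\<le>i. N l)"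
  shows "flow_of_packing n N x \<in> flow_polytope n (netflow_vec N n)"
  unfolding flow_polytope_iff_cut_flow
proof (intro conjI allI impI)
  fix i j assume "\<not> (i < j \<and> j \<le> n)"
  then show "flow_of_packing n N x i j = 0"
    by (auto simp: flow_of_packing_def skip_arcs_def)
next
  fix i j assume "i < j \<and> j \<le> n"
  then show "0 \<le> flow_of_packing n N x i j"
    using x le [of i] by (auto simp: flow_of_packing_def)
next
  fix i assume i: "i \<le> n"
  show "cut_flow n (flow_of_packing n N x) i = of_int (\<Sum>l\<le>i. netflow_vec N n l)"
  proof (cases "i < n")
    case True
    have "(\<Sum>(k, j)\<in>skip_arcs_across n i. flow_of_packing n N x k j) = (\<Sum>e\<in>skip_arcs_across n i. x e)"
      by (intro sum.cong) (auto simp: flow_of_packing_def skip_arcs_across_def)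
    moreover have "(i, Suc i) \<notin> skip_arcs n" by (simp add: skip_arcs_def)
    ultimately show ?thesis
      using True i by (simp add: cut_flow_eq_across sum_netflow_vec flow_of_packing_def)
  next
    case False
    with i show ?thesis by (simp add: cut_flow_def sum_netflow_vec)
  qed
qed

section \<open>Bounds on flows and entropies for positive netflows\<close>

context
  fixes N :: "nat \<Rightarrow> int" and n :: nat
  assumes pos: "\<And>i. N i > 0"
begin

abbreviation "flows \<equiv> flow_polytope n (netflow_vec N n)"
abbreviation "total_supply \<equiv> real_of_int (\<Sum>l<n. N l)"

lemma partial_sum_ge: "int i + 1 \<le> (\<Sum>l\<le>i. N l)"
proof -
  have "(\<Sum>l\<le>i. 1) \<le> (\<Sum>l\<le>i. N l)"
    using pos by (intro sum_mono) (simp add: int_one_le_iff_zero_less)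
  then show ?thesis by simp
qed

lemma partial_sum_le_total: "i < n \<Longrightarrow> real_of_int (\<Sum>l\<le>i. N l) \<le> total_supply"
  unfolding of_int_le_iff using pos by (intro sum_mono2) (auto intro: less_imp_le)

lemma total_supply_nonneg: "total_supply \<ge> 0"
  unfolding of_int_0_le_iff using pos by (intro sum_nonneg less_imp_le)

lemma flow_nonneg: "f \<in> flows \<Longrightarrow> f i j \<ge> 0"
  by (cases "i < j \<and> j \<le> n") (auto simp: flow_polytope_def)

lemma cut_flow_polytope:
  assumes "f \<in> flows" "i < n"
  shows "cut_flow n f i = of_int (\<Sum>l\<le>i. N l)"
  using assms by (simp add: flow_polytope_iff_cut_flow sum_netflow_vec)

text \<open>An arc crosses the cut just after its tail, and that cut carries a partial sum of the
  netflows.\<close>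

lemma flow_le_total:
  assumes f: "f \<in> flows"
  shows "f i j \<le> total_supply"
proof (cases "i < j \<and> j \<le> n")
  case True
  have "f i j \<le> (\<Sum>j\<in>{i<..n}. f i j)"
    using True flow_nonneg [OF f] by (intro member_le_sum) auto
  also have "\<dots> \<le> cut_flow n f i"
    unfolding cut_flow_def using flow_nonneg [OF f]
    by (intro member_le_sum [of i "{..i}" "\<lambda>k. \<Sum>j\<in>{i<..n}. f k j"]) (auto intro: sum_nonneg)
  also have "\<dots> \<le> total_supply"
    using cut_flow_polytope [OF f] partial_sum_le_total True by simp
  finally show ?thesis .
next
  case False
  then have "f i j = 0" using f by (auto simp: flow_polytope_def)
  then show ?thesis using total_supply_nonneg by simp
qed

text \<open>The argument of \<open>hfun\<close> in the second entropy sum is the flow on arcs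
  jumping over \<open>j\<close>: what crosses the cut before \<open>j\<close> minus what ends in
  \<open>j\<close>.\<close>

lemma transit_flow_bounds:
  assumes f: "f \<in> flows" and j: "0 < j" "j < n"
  shows "0 \<le> (\<Sum>i<j. (of_int (netflow_vec N n i) - f i j))"
    and "(\<Sum>i<j. (of_int (netflow_vec N n i) - f i j)) \<le> total_supply"
proof -
  obtain i where i: "j = Suc i" using j by (cases j) auto
  have "{i<..n} = insert j {j<..n}" using i j by auto
  then have "cut_flow n f i = (\<Sum>k<j. f k j) + (\<Sum>k<j. \<Sum>l\<in>{j<..n}. f k l)"
    by (simp add: cut_flow_def i lessThan_Suc_atMost sum.distrib)
  moreover have "cut_flow n f i = (\<Sum>k<j. of_int (netflow_vec N n k))"
    using cut_flow_polytope [OF f, of i] i j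
    by (simp add: lessThan_Suc_atMost netflow_vec_def)
  ultimately have eq: "(\<Sum>i<j. (of_int (netflow_vec N n i) - f i j)) = (\<Sum>k<j. \<Sum>l\<in>{j<..n}. f k l)"
    by (simp add: sum_subtractf)
  show "0 \<le> (\<Sum>i<j. (of_int (netflow_vec N n i) - f i j))"
    unfolding eq by (intro sum_nonneg flow_nonneg [OF f])
  have "0 \<le> (\<Sum>k<j. f k j)" by (intro sum_nonneg flow_nonneg [OF f])
  then have "(\<Sum>k<j. \<Sum>l\<in>{j<..n}. f k l) \<le> cut_flow n f i"
    using \<open>cut_flow n f i = (\<Sum>k<j. f k j) + _\<close> by simp
  also have "\<dots> \<le> total_supply"
    using cut_flow_polytope [OF f] partial_sum_le_total i j by simp
  finally show "(\<Sum>i<j. (of_int (netflow_vec N n i) - f i j)) \<le> total_supply"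
    unfolding eq .
qed

lemma flow_entropy_eq:
  "flow_entropy n (netflow_vec N n) f = (\<Sum>(k, j)\<in>arcs n. hfun (f k j)) +
     (\<Sum>j\<in>{0<..<n}. hfun (\<Sum>i<j. (of_int (netflow_vec N n i) - f i j)))"
proof -
  have "(\<Sum>j\<in>{1..n}. \<Sum>i<j. hfun (f i j)) = (\<Sum>(j, i)\<in>Sigma {1..n} (\<lambda>j. {..<j}). hfun (f i j))"
    by (simp add: sum.Sigma)
  also have "\<dots> = (\<Sum>(k, j)\<in>arcs n. hfun (f k j))"
    by (rule sum.reindex_bij_witness [of _ "\<lambda>(k, j). (j, k)" "\<lambda>(j, i). (i, j)"])
      (auto simp: arcs_def)
  finally show ?thesis by (simp add: flow_entropy_def)
qed

lemma sum_arcs_le_flow_entropy: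
  assumes f: "f \<in> flows"
  shows "(\<Sum>(k, j)\<in>arcs n. hfun (f k j)) \<le> flow_entropy n (netflow_vec N n) f"
proof -
  have "0 \<le> (\<Sum>j\<in>{0<..<n}. hfun (\<Sum>i<j. (of_int (netflow_vec N n i) - f i j)))"
    by (rule sum_nonneg, rule hfun_nonneg, rule transit_flow_bounds(1) [OF f]) auto
  then show ?thesis by (simp add: flow_entropy_eq)
qed

lemma sum_skip_arcs_le_sum_arcs:
  assumes f: "f \<in> flows"
  shows "(\<Sum>(k, j)\<in>skip_arcs n. hfun (f k j)) \<le> (\<Sum>(k, j)\<in>arcs n. hfun (f k j))"
  using flow_nonneg [OF f] finite_arcs [of n]
  by (intro sum_mono2) (auto simp: arcs_eq intro: hfun_nonneg)

text \<open>The \<open>n\<close> adjacent arcs and at most \<open>n\<close> transit terms cost a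
  logarithm each, in total \<open>O(n * ln n)\<close> under polynomial growth.\<close>

lemma flow_entropy_le_sum_skip_arcs:
  assumes f: "f \<in> flows"
  shows "flow_entropy n (netflow_vec N n) f
    \<le> (\<Sum>(k, j)\<in>skip_arcs n. hfun (f k j)) + 2 * n * (ln (1 + total_supply) + 1)"
proof -
  have B: "ln (1 + total_supply) + 1 \<ge> 0"
    using total_supply_nonneg by (intro add_nonneg_nonneg ln_ge_zero) auto
  have "(\<Sum>(k, j)\<in>arcs n. hfun (f k j))
      = (\<Sum>(k, j)\<in>skip_arcs n. hfun (f k j)) + (\<Sum>i<n. hfun (f i (Suc i)))"
    unfolding arcs_eq
    by (subst sum.union_disjoint [OF finite_skip_arcs])
      (auto simp: skip_arcs_def sum.reindex inj_on_def)
  moreover have "(\<Sum>i<n. hfun (f i (Suc i))) \<le> n * (ln (1 + total_supply) + 1)"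
    using sum_bounded_above [of "{..<n}" "\<lambda>i. hfun (f i (Suc i))" "ln (1 + total_supply) + 1"]
      hfun_le [OF flow_nonneg [OF f] flow_le_total [OF f]] by simp
  moreover have "(\<Sum>j\<in>{0<..<n}. hfun (\<Sum>i<j. (of_int (netflow_vec N n i) - f i j)))
      \<le> n * (ln (1 + total_supply) + 1)"
  proof -
    have "(\<Sum>j\<in>{0<..<n}. hfun (\<Sum>i<j. (of_int (netflow_vec N n i) - f i j)))
      \<le> card {0<..<n} * (ln (1 + total_supply) + 1)"
      using transit_flow_bounds [OF f] by (intro sum_bounded_above hfun_le) auto
    also have "\<dots> \<le> n * (ln (1 + total_supply) + 1)"
      using B by (intro mult_right_mono) auto
    finally show ?thesis .
  qed
  ultimately show ?thesis by (simp add: flow_entropy_eq)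
qed

lemma bdd_above_flow_entropy: "bdd_above (flow_entropy n (netflow_vec N n) ` flows)"
proof (rule bdd_aboveI2)
  fix f assume f: "f \<in> flows"
  have "(\<Sum>(k, j)\<in>skip_arcs n. hfun (f k j)) \<le> card (skip_arcs n) * (ln (1 + total_supply) + 1)"
    using hfun_le [OF flow_nonneg [OF f] flow_le_total [OF f]]
    by (intro sum_bounded_above) auto
  then show "flow_entropy n (netflow_vec N n) f
      \<le> card (skip_arcs n) * (ln (1 + total_supply) + 1) + 2 * n * (ln (1 + total_supply) + 1)"
    using flow_entropy_le_sum_skip_arcs [OF f] by simp
qed

text \<open>Convexity, applied to a barycentre.\<close>

lemma mean_in_polytope:
  assumes L: "finite L" "L \<noteq> {}" "L \<subseteq> flows"
  shows "(\<lambda>i j. (\<Sum>f\<in>L. f i j) / card L) \<in> flows"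
proof -
  define g where "g i j = (\<Sum>f\<in>L. f i j) / card L" for i j
  have K: "real (card L) \<noteq> 0" using L by simp
  have "(\<Sum>j\<in>{i<..n}. g i j) - (\<Sum>k<i. g k i) = of_int (netflow_vec N n i)" if "i \<le> n" for i
  proof -
    have "(\<Sum>j\<in>{i<..n}. \<Sum>f\<in>L. f i j) - (\<Sum>k<i. \<Sum>f\<in>L. f k i)
        = (\<Sum>f\<in>L. (\<Sum>j\<in>{i<..n}. f i j) - (\<Sum>k<i. f k i))"
      by (simp add: sum_subtractf) (simp add: sum.swap [of _ L])
    also have "\<dots> = (\<Sum>f\<in>L. of_int (netflow_vec N n i))"
      using L that by (intro sum.cong) (auto simp: flow_polytope_def)
    finally show ?thesis
      using K by (simp add: g_def sum_divide_distrib [symmetric] diff_divide_distrib [symmetric])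
  qed
  moreover have "g i j = 0" if "\<not> (i < j \<and> j \<le> n)" for i j
    unfolding g_def using that L by (subst sum.neutral) (auto simp: flow_polytope_def)
  moreover have "g i j \<ge> 0" for i j
    unfolding g_def using L flow_nonneg by (intro divide_nonneg_nonneg sum_nonneg) auto
  ultimately have "g \<in> flows" by (simp add: flow_polytope_def)
  then show ?thesis by (simp add: g_def [abs_def])
qed

section \<open>Upper bound: the mean of all integer flows\<close>

abbreviation "lattice_flows \<equiv> {f \<in> flows. \<forall>i j. f i j \<in> \<int>}"

definition arc_value :: "(nat \<Rightarrow> nat \<Rightarrow> real) \<Rightarrow> nat \<times> nat \<Rightarrow> nat" where
  "arc_value f e = nat \<lfloor>f (fst e) (snd e)\<rfloor>"

lemma real_arc_value: "f \<in> lattice_flows \<Longrightarrow> real (arc_value f e) = f (fst e) (snd e)"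
  using flow_nonneg by (auto simp: arc_value_def of_nat_nat elim!: Ints_cases)

lemma inj_on_arc_value: "inj_on (\<lambda>f. restrict (arc_value f) (arcs n)) lattice_flows"
proof (rule inj_onI)
  fix f g assume fg: "f \<in> lattice_flows" "g \<in> lattice_flows"
    and eq: "restrict (arc_value f) (arcs n) = restrict (arc_value g) (arcs n)"
  have "f i j = g i j" for i j
  proof (cases "i < j \<and> j \<le> n")
    case True
    then have "arc_value f (i, j) = arc_value g (i, j)"
      using fun_cong [OF eq, of "(i, j)"] by (simp add: arcs_def)
    then show ?thesis
      using real_arc_value [OF fg(1), of "(i, j)"] real_arc_value [OF fg(2), of "(i, j)"] by simp
  next
    case False
    then show ?thesis using fg by (auto simp: flow_polytope_def)
  qed
  then show "f = g" by blast
qed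

lemma finite_lattice_flows: "finite lattice_flows"
proof (rule finite_imageD [OF _ inj_on_arc_value])
  have "arc_value f e \<le> nat (\<Sum>l<n. N l)" if "f \<in> lattice_flows" for f e
  proof -
    have "\<lfloor>f (fst e) (snd e)\<rfloor> \<le> \<lfloor>total_supply\<rfloor>"
      using that flow_le_total by (intro floor_mono) auto
    then have "\<lfloor>f (fst e) (snd e)\<rfloor> \<le> (\<Sum>l<n. N l)" by (simp only: floor_of_int)
    then show ?thesis by (simp add: arc_value_def nat_mono)
  qed
  then have "(\<lambda>f. restrict (arc_value f) (arcs n)) ` lattice_flows
      \<subseteq> arcs n \<rightarrow>\<^sub>E {..nat (\<Sum>l<n. N l)}"
    by auto
  then show "finite ((\<lambda>f. restrict (arc_value f) (arcs n)) ` lattice_flows)"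
    by (rule finite_subset) (simp add: finite_PiE finite_arcs)
qed

text \<open>Gibbs' inequality on all arcs; the mean \<open>g\<close> is itself a flow, and the
  transit terms only increase its entropy.\<close>

lemma ln_lattice_count_le_Sup:
  assumes "lattice_flows \<noteq> {}"
  shows "ln (real (lattice_count n (netflow_vec N n)))
    \<le> Sup (flow_entropy n (netflow_vec N n) ` flows)"
proof -
  define g where "g = (\<lambda>i j. (\<Sum>f\<in>lattice_flows. f i j) / card lattice_flows)"
  have g: "g \<in> flows"
    unfolding g_def using finite_lattice_flows assms by (intro mean_in_polytope) auto
  have "ln (real (lattice_count n (netflow_vec N n)))
      \<le> (\<Sum>e\<in>arcs n. hfun ((\<Sum>f\<in>lattice_flows. real (arc_value f e)) / card lattice_flows))"
    unfolding lattice_count_def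
    by (rule ln_card_le_sum_hfun [OF finite_arcs finite_lattice_flows assms inj_on_arc_value])
  also have "\<dots> = (\<Sum>(k, j)\<in>arcs n. hfun (g k j))"
    by (intro sum.cong) (auto simp: g_def real_arc_value split_def)
  also have "\<dots> \<le> flow_entropy n (netflow_vec N n) g"
    by (rule sum_arcs_le_flow_entropy [OF g])
  also have "\<dots> \<le> Sup (flow_entropy n (netflow_vec N n) ` flows)"
    using g bdd_above_flow_entropy by (intro cSup_upper) auto
  finally show ?thesis .
qed

section \<open>Lower bound: counting integer packings\<close>

abbreviation "lattice_packings \<equiv>
  packings (skip_arcs n) {..<n} (skip_arcs_across n) (\<lambda>i. nat (\<Sum>l\<le>i. N l))"

lemma flow_of_lattice_packing:
  assumes "x \<in> lattice_packings"
  shows "flow_of_packing n N (\<lambda>e. real (x e)) \<in> lattice_flows"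
proof -
  have "(\<Sum>e\<in>skip_arcs_across n i. real (x e)) \<le> of_int (\<Sum>l\<le>i. N l)" if "i < n" for i
  proof -
    have "(\<Sum>e\<in>skip_arcs_across n i. x e) \<le> nat (\<Sum>l\<le>i. N l)"
      using assms that by (simp add: packings_def)
    then have "int (\<Sum>e\<in>skip_arcs_across n i. x e) \<le> (\<Sum>l\<le>i. N l)"
      using partial_sum_ge [of i] by linarith
    then have "real_of_int (int (\<Sum>e\<in>skip_arcs_across n i. x e)) \<le> of_int (\<Sum>l\<le>i. N l)"
      by (simp only: of_int_le_iff)
    then show ?thesis by simp
  qed
  then have "flow_of_packing n N (\<lambda>e. real (x e)) \<in> flows"
    by (intro flow_of_packing_in_polytope) auto
  then show ?thesis by (auto simp: flow_of_packing_def intro!: Ints_diff Ints_sum)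
qed

lemma card_lattice_packings_le: "card lattice_packings \<le> lattice_count n (netflow_vec N n)"
  unfolding lattice_count_def
proof (rule card_inj_on_le [OF _ _ finite_lattice_flows])
  show "inj_on (\<lambda>x. flow_of_packing n N (\<lambda>e. real (x e))) lattice_packings"
  proof (rule inj_onI)
    fix x y assume xy: "x \<in> lattice_packings" "y \<in> lattice_packings"
      and eq: "flow_of_packing n N (\<lambda>e. real (x e)) = flow_of_packing n N (\<lambda>e. real (y e))"
    have "x e = y e" if "e \<in> skip_arcs n" for e
      using fun_cong [OF fun_cong [OF eq, of "fst e"], of "snd e"] that
      by (simp add: flow_of_packing_def)
    then show "x = y"
      using xy by (auto simp: packings_def intro: extensionalityI)
  qed
  show "(\<lambda>x. flow_of_packing n N (\<lambda>e. real (x e))) ` lattice_packings \<subseteq> lattice_flows"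
    using flow_of_lattice_packing by blast
qed

lemma lattice_packings_nonempty: "lattice_packings \<noteq> {}"
proof -
  have "restrict (\<lambda>_. 0) (skip_arcs n) \<in> lattice_packings"
    unfolding packings_def
    by (auto simp: skip_arcs_across_def intro!: order.trans [OF eq_imp_le [OF sum.neutral]])
  then show ?thesis by blast
qed

lemma lattice_flows_nonempty: "lattice_flows \<noteq> {}"
  using flow_of_lattice_packing lattice_packings_nonempty by blast

lemma ln_lattice_packings_le: "ln (card lattice_packings) \<le> ln (real (lattice_count n (netflow_vec N n)))"
proof (cases "card lattice_packings = 0")
  \<comment> \<open>Here \<open>ln 0 = 0\<close>, and there is at least one integer flow.\<close>
  case True
  have "card lattice_flows > 0"
    using lattice_flows_nonempty finite_lattice_flows by (simp only: card_gt_0_iff) blast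
  then have "ln (real (lattice_count n (netflow_vec N n))) \<ge> 0"
    by (intro ln_ge_zero) (simp add: lattice_count_def)
  with True show ?thesis by simp
next
  case False
  then show ?thesis using card_lattice_packings_le by (intro ln_mono) auto
qed

text \<open>The factor collects the shrinking of \<open>f\<close> and the Renyi loss. The errors
  come, in order, from the probability \<open>\<epsilon> ^ n\<close>, from adjacent arcs and transit
  terms, and from arcs of tiny flow.\<close>

lemma flow_entropy_le_ln_lattice_count:
  assumes f: "f \<in> flows" and \<epsilon>: "0 < \<epsilon>" "\<epsilon> < 1" and \<theta>: "\<theta> > 0" and n: "n \<ge> 2"
  shows "(1 - \<epsilon>) * exp (- 3 * \<theta> * ln n) / (1 + \<theta>) * flow_entropy n (netflow_vec N n) f
     \<le> ln (real (lattice_count n (netflow_vec N n)))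
       + ((1 + \<theta>) / \<theta> * n * ln (1 / \<epsilon>) + 2 * n * (ln (1 + total_supply) + 1) + 3 * n)"
proof -
  define \<kappa> where "\<kappa> = (1 - \<epsilon>) * exp (- 3 * \<theta> * ln n) / (1 + \<theta>)"
  \<comment> \<open>Shrinking by \<open>1 - \<epsilon>\<close> creates the room that Markov's
    inequality needs.\<close>
  define t where "t e = (1 - \<epsilon>) * f (fst e) (snd e)" for e
  define \<phi> where "\<phi> e = exp (- \<theta> * ln (1 + 1 / t e)) / (1 + \<theta>) * hfun (t e)" for e
  define K where "K = real (lattice_count n (netflow_vec N n))"
  have t0: "t e \<ge> 0" for e using flow_nonneg [OF f] \<epsilon> by (simp add: t_def)
  have "- 3 * \<theta> * ln n \<le> 0" using \<theta> n by (simp add: mult_nonneg_nonneg)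
  then have "exp (- 3 * \<theta> * ln n) / (1 + \<theta>) \<le> 1"
    using \<theta> by (simp add: divide_le_eq add_increasing2)
  then have \<kappa>: "0 \<le> \<kappa>" "\<kappa> \<le> 1 - \<epsilon>"
    using \<epsilon> \<theta> mult_left_mono [of "exp (- 3 * \<theta> * ln n) / (1 + \<theta>)" 1 "1 - \<epsilon>"]
    by (auto simp: \<kappa>_def)
  have h_nonneg: "hfun (f i j) \<ge> 0" for i j using flow_nonneg [OF f] by (intro hfun_nonneg)
  have scale: "(1 - \<epsilon>) * hfun (f (fst e) (snd e)) \<le> hfun (t e)" for e
    unfolding t_def using flow_nonneg [OF f] \<epsilon> by (intro hfun_scale) auto
  have "(1 + \<theta>) * card {..<n} * ln \<epsilon> + \<theta> * (\<Sum>e\<in>skip_arcs n. \<phi> e) \<le> \<theta> * ln (card lattice_packings)"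
    unfolding \<phi>_def
  proof (rule ln_card_packings_ge)
    fix i assume i: "i \<in> {..<n}"
    have "f i (Suc i) \<ge> 0" using flow_nonneg [OF f] .
    then have "(\<Sum>(k, j)\<in>skip_arcs_across n i. f k j) \<le> of_int (\<Sum>l\<le>i. N l)"
      using cut_flow_polytope [OF f, of i] cut_flow_eq_across [of i n f] i by simp
    also have "of_int (\<Sum>l\<le>i. N l) = real (nat (\<Sum>l\<le>i. N l))"
      using partial_sum_ge [of i] by (intro of_nat_nat [symmetric]) linarith
    finally have "(1 - \<epsilon>) * (\<Sum>(k, j)\<in>skip_arcs_across n i. f k j) \<le> (1 - \<epsilon>) * real (nat (\<Sum>l\<le>i. N l))"
      using \<epsilon> by (intro mult_left_mono) auto
    then show "(\<Sum>e\<in>skip_arcs_across n i. t e) \<le> (1 - \<epsilon>) * real (nat (\<Sum>l\<le>i. N l))"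
      by (simp add: t_def sum_distrib_left split_def)
    show "nat (\<Sum>l\<le>i. N l) > 0"
      using partial_sum_ge [of i] by linarith
  next
    fix e assume "e \<in> skip_arcs n"
    then show "\<exists>i\<in>{..<n}. e \<in> skip_arcs_across n i"
      by (intro bexI [of _ "fst e"]) (auto simp: skip_arcs_across_def skip_arcs_def)
  qed (use t0 \<epsilon> \<theta> finite_skip_arcs in \<open>auto simp: skip_arcs_across_def\<close>)
  also have "\<dots> \<le> \<theta> * ln K"
    unfolding K_def using ln_lattice_packings_le \<theta> by (intro mult_left_mono) auto
  finally have "((1 + \<theta>) * n * ln \<epsilon> + \<theta> * (\<Sum>e\<in>skip_arcs n. \<phi> e)) / \<theta> \<le> ln K"
    using \<theta> by (simp add: divide_le_eq mult.commute)
  moreover have "((1 + \<theta>) * n * ln \<epsilon> + \<theta> * (\<Sum>e\<in>skip_arcs n. \<phi> e)) / \<theta>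
      = (1 + \<theta>) * n * ln \<epsilon> / \<theta> + (\<Sum>e\<in>skip_arcs n. \<phi> e)"
    using \<theta> unfolding add_divide_distrib by simp
  moreover have "(1 + \<theta>) / \<theta> * n * ln (1 / \<epsilon>) = - ((1 + \<theta>) * n * ln \<epsilon> / \<theta>)"
    using \<epsilon> by (simp add: ln_div)
  ultimately have main: "(\<Sum>e\<in>skip_arcs n. \<phi> e) \<le> ln K + (1 + \<theta>) / \<theta> * n * ln (1 / \<epsilon>)"
    by linarith
  \<comment> \<open>Above the threshold \<open>1 / n^2\<close> one has
    \<open>1 + 1 / t e \<le> n^3\<close>, which explains the 3 in the exponent; below it the entropy
    is at most \<open>3 / n\<close>.\<close>
  have ent: "\<kappa> * hfun (f (fst e) (snd e)) - 3 / n \<le> \<phi> e" for e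
  proof (cases "t e \<ge> 1 / n\<^sup>2")
    case True
    have n0: "real n \<ge> 2" "0 < t e" using n True less_le_trans [of 0 "1 / (real n)\<^sup>2" "t e"] by auto
    have "1 / t e \<le> n\<^sup>2" using True n0 by (simp add: field_simps)
    moreover have "1 + real n ^ 2 \<le> real n ^ 3"
    proof -
      have "1 \<le> real n ^ 2" using n0 by simp
      moreover have "2 * real n ^ 2 \<le> real n * real n ^ 2" using n0 by (intro mult_right_mono) auto
      ultimately show ?thesis by (simp add: power3_eq_cube power2_eq_square)
    qed
    ultimately have "1 + 1 / t e \<le> real n ^ 3" by simp
    then have "ln (1 + 1 / t e) \<le> ln (real n ^ 3)"
      using n0 by (intro ln_mono) (auto intro: add_pos_pos)
    also have "\<dots> = 3 * ln n" using n0 by (simp add: ln_realpow)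
    finally have "\<theta> * ln (1 + 1 / t e) \<le> \<theta> * (3 * ln n)"
      using \<theta> by (intro mult_left_mono) auto
    then have "exp (- 3 * \<theta> * ln n) / (1 + \<theta>) \<le> exp (- \<theta> * ln (1 + 1 / t e)) / (1 + \<theta>)"
      using \<theta> by (intro divide_right_mono) (auto simp: mult_ac)
    then have "exp (- 3 * \<theta> * ln n) / (1 + \<theta>) * ((1 - \<epsilon>) * hfun (f (fst e) (snd e))) \<le> \<phi> e"
      unfolding \<phi>_def using \<theta> \<epsilon> h_nonneg by (intro mult_mono scale) auto
    then have "\<kappa> * hfun (f (fst e) (snd e)) \<le> \<phi> e" by (simp add: \<kappa>_def mult_ac)
    moreover have "3 / real n \<ge> 0" by simp
    ultimately show ?thesis by linarith
  next
    case False
    have "1 / (real n)\<^sup>2 \<le> 1" using n by simp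
    with False have "t e \<le> 1" by simp
    have "\<kappa> * hfun (f (fst e) (snd e)) \<le> (1 - \<epsilon>) * hfun (f (fst e) (snd e))"
      using \<kappa> h_nonneg by (intro mult_right_mono) auto
    also have "\<dots> \<le> hfun (t e)" by (rule scale)
    also have "\<dots> \<le> 3 * sqrt (t e)" using t0 \<open>t e \<le> 1\<close> by (intro hfun_le_sqrt)
    also have "\<dots> \<le> 3 * sqrt (1 / n\<^sup>2)" using False by (intro mult_left_mono real_sqrt_le_mono) auto
    also have "\<dots> = 3 / n" by (simp add: real_sqrt_divide)
    finally have "\<kappa> * hfun (f (fst e) (snd e)) - 3 / n \<le> 0" by simp
    also have "0 \<le> \<phi> e" using \<theta> hfun_nonneg [OF t0] by (simp add: \<phi>_def)
    finally show ?thesis .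
  qed
  have "real (card (skip_arcs n)) \<le> real n * real n"
    using card_skip_arcs_le [of n] by (simp flip: of_nat_mult)
  then have "real (card (skip_arcs n)) * (3 / n) \<le> real n * real n * (3 / n)"
    by (intro mult_right_mono) auto
  then have card3: "real (card (skip_arcs n)) * (3 / n) \<le> 3 * n" using n by simp
  have "\<kappa> * (\<Sum>(k, j)\<in>skip_arcs n. hfun (f k j)) - card (skip_arcs n) * (3 / n)
      = (\<Sum>e\<in>skip_arcs n. \<kappa> * hfun (f (fst e) (snd e)) - 3 / n)"
    by (simp add: sum_subtractf sum_distrib_left split_def)
  also have "\<dots> \<le> (\<Sum>e\<in>skip_arcs n. \<phi> e)" by (intro sum_mono ent)
  finally have 1: "\<kappa> * (\<Sum>(k, j)\<in>skip_arcs n. hfun (f k j))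
      \<le> ln K + (1 + \<theta>) / \<theta> * n * ln (1 / \<epsilon>) + 3 * n"
    using main card3 by linarith
  define D where "D = 2 * n * (ln (1 + total_supply) + 1)"
  have "D \<ge> 0"
    unfolding D_def using total_supply_nonneg by (intro mult_nonneg_nonneg add_nonneg_nonneg ln_ge_zero) auto
  then have "\<kappa> * D \<le> D" using \<kappa> \<epsilon> by (intro mult_left_le_one_le) auto
  moreover have "\<kappa> * flow_entropy n (netflow_vec N n) f
      \<le> \<kappa> * ((\<Sum>(k, j)\<in>skip_arcs n. hfun (f k j)) + D)"
    unfolding D_def using \<kappa> by (intro mult_left_mono flow_entropy_le_sum_skip_arcs [OF f])
  ultimately show ?thesis
    using 1 unfolding \<kappa>_def [symmetric] K_def [symmetric] D_def [symmetric]
    unfolding distrib_left by linarith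
qed

section \<open>Order of magnitude of the maximal entropy\<close>

lemma Sup_flow_entropy_ge:
  assumes m: "3 * m \<le> n"
  shows "Sup (flow_entropy n (netflow_vec N n) ` flows) \<ge> m * (((ln (real m + 1))\<^sup>2 - (ln 2)\<^sup>2) / 2)"
proof -
  \<comment> \<open>An arc of length \<open>d\<close> carries \<open>1 / d\<close>. Each of the
    \<open>m\<close> tails then contributes about half of \<open>(ln m)^2\<close> to the entropy,
    and \<open>3 * m \<le> n\<close> leaves room for all heads.\<close>
  define x :: "nat \<times> nat \<Rightarrow> real" where
    "x e = (if m \<le> fst e \<and> fst e < 2 * m \<and> snd e \<le> fst e + m then 1 / (snd e - fst e) else 0)" for e
  define f where "f = flow_of_packing n N x"
  have x0: "x e \<ge> 0" if "e \<in> skip_arcs n" for e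
    using that by (auto simp: x_def skip_arcs_def)
  have f: "f \<in> flows"
    unfolding f_def
  proof (rule flow_of_packing_in_polytope [OF x0])
    fix i assume i: "i < n"
    show "(\<Sum>e\<in>skip_arcs_across n i. x e) \<le> of_int (\<Sum>l\<le>i. N l)"
    proof (cases "i < m")
      case True
      then have "(\<Sum>e\<in>skip_arcs_across n i. x e) = 0"
        by (intro sum.neutral) (auto simp: skip_arcs_across_def x_def)
      moreover have "0 \<le> (\<Sum>l\<le>i. N l)" using partial_sum_ge [of i] by linarith
      ultimately show ?thesis by (simp only: of_int_0_le_iff)
    next
      case False
      define B where "B = {e \<in> skip_arcs_across n i. m \<le> fst e \<and> fst e < 2 * m \<and> snd e \<le> fst e + m}"
      have fin: "finite B" by (simp add: B_def finite_skip_arcs_across)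
      have inj: "inj_on (\<lambda>e. (snd e - fst e, fst e)) B"
        by (auto simp: inj_on_def B_def skip_arcs_across_def skip_arcs_def)
      have "(\<Sum>e\<in>skip_arcs_across n i. x e) = (\<Sum>e\<in>B. 1 / real (snd e - fst e))"
        using finite_skip_arcs_across [of n i]
        by (intro sum.mono_neutral_cong_right)
          (auto simp: B_def x_def skip_arcs_across_def skip_arcs_def of_nat_diff)
      also have "\<dots> = (\<Sum>(d, k)\<in>(\<lambda>e. (snd e - fst e, fst e)) ` B. 1 / real d)"
        using inj by (simp add: sum.reindex)
      \<comment> \<open>For each length \<open>d\<close> at most \<open>d\<close> tails reach across
        the cut, so each length loads it by at most 1. As \<open>m \<le> i\<close>, the subtraction
        \<open>i - d\<close> is exact and the load stays below the capacity, which is at least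
        \<open>i + 1\<close>.\<close>
      also have "\<dots> \<le> (\<Sum>(d, k)\<in>Sigma {2..m} (\<lambda>d. {i - d<..i}). 1 / real d)"
        by (intro sum_mono2) (auto simp: B_def skip_arcs_across_def skip_arcs_def)
      also have "\<dots> = (\<Sum>d\<in>{2..m}. \<Sum>k\<in>{i - d<..i}. 1 / real d)"
        by (rule sum.Sigma [symmetric]) auto
      also have "\<dots> \<le> (\<Sum>d\<in>{2..m}. 1)"
        using False by (intro sum_mono) auto
      also have "\<dots> \<le> real i + 1" using False by simp
      also have "\<dots> = of_int (int i + 1)" by simp
      also have "\<dots> \<le> of_int (\<Sum>l\<le>i. N l)"
        unfolding of_int_le_iff by (rule partial_sum_ge)
      finally show ?thesis .
    qed
  qed
  \<comment> \<open>Discrete integration of \<open>ln x / x\<close>: the increment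
    \<open>v^2 - u^2 = (v - u) * (v + u)\<close> is at most \<open>2 * v / Suc m\<close>.\<close>
  have log_sum: "((ln (1 + real m))\<^sup>2 - (ln 2)\<^sup>2) / 2 \<le> (\<Sum>d\<in>{2..m}. ln (1 + real d) / d)" if "m \<ge> 1" for m :: nat
    using that
  proof (induction m rule: dec_induct)
    case (step m)
    define u where "u = ln (1 + real m)"
    define v where "v = ln (1 + real (Suc m))"
    have uv: "0 \<le> u" "u \<le> v" unfolding u_def v_def by (auto intro: ln_mono)
    have "v - u \<le> (1 + real (Suc m) - (1 + real m)) / (1 + real m)"
      unfolding u_def v_def by (intro ln_diff_le) auto
    then have "v - u \<le> 1 / real (Suc m)" by (simp add: add.commute)
    then have "(v - u) * (v + u) \<le> 1 / real (Suc m) * (2 * v)"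
      using uv by (intro mult_mono) auto
    then have "(v\<^sup>2 - u\<^sup>2) / 2 \<le> v / real (Suc m)"
      by (simp add: power2_eq_square algebra_simps)
    moreover have "(\<Sum>d\<in>{2..Suc m}. ln (1 + real d) / d) = (\<Sum>d\<in>{2..m}. ln (1 + real d) / d) + v / real (Suc m)"
      using step by (simp add: v_def)
    moreover have "(u\<^sup>2 - (ln 2)\<^sup>2) / 2 \<le> (\<Sum>d\<in>{2..m}. ln (1 + real d) / d)"
      using step by (simp add: u_def)
    ultimately show ?case
      unfolding v_def [symmetric] diff_divide_distrib by linarith
  qed simp
  have "m * (((ln (real m + 1))\<^sup>2 - (ln 2)\<^sup>2) / 2) \<le> m * (\<Sum>d\<in>{2..m}. ln (1 + real d) / d)"
    using log_sum [of m] by (cases "m = 0") (auto intro!: mult_left_mono simp: add.commute)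
  also have "\<dots> = (\<Sum>k\<in>{m..<2 * m}. \<Sum>d\<in>{2..m}. ln (1 + real d) / d)"
    by simp
  \<comment> \<open>Only the second summand of \<open>hfun_altdef\<close> at \<open>1 / d\<close> is
    kept.\<close>
  also have "\<dots> \<le> (\<Sum>k\<in>{m..<2 * m}. \<Sum>d\<in>{2..m}. hfun (1 / real d))"
  proof (intro sum_mono)
    fix d :: nat assume "d \<in> {2..m}"
    then show "ln (1 + real d) / d \<le> hfun (1 / real d)"
      by (simp add: hfun_altdef)
  qed
  also have "\<dots> = (\<Sum>(k, d)\<in>{m..<2 * m} \<times> {2..m}. hfun (1 / real d))"
    by (rule sum.cartesian_product)
  also have "\<dots> = (\<Sum>(k, d)\<in>{m..<2 * m} \<times> {2..m}. hfun (f k (k + d)))"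
    using m by (intro sum.cong) (auto simp: f_def flow_of_packing_def skip_arcs_def x_def)
  also have "\<dots> = (\<Sum>(k, j)\<in>(\<lambda>(k, d). (k, k + d)) ` ({m..<2 * m} \<times> {2..m}). hfun (f k j))"
    by (subst sum.reindex) (auto simp: inj_on_def split_def)
  also have "\<dots> \<le> (\<Sum>(k, j)\<in>skip_arcs n. hfun (f k j))"
    using m flow_nonneg [OF f] by (intro sum_mono2 finite_skip_arcs) (auto simp: skip_arcs_def intro: hfun_nonneg)
  also have "\<dots> \<le> flow_entropy n (netflow_vec N n) f"
    using sum_skip_arcs_le_sum_arcs [OF f] sum_arcs_le_flow_entropy [OF f] by linarith
  also have "\<dots> \<le> Sup (flow_entropy n (netflow_vec N n) ` flows)"
    using f bdd_above_flow_entropy by (intro cSup_upper) auto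
  finally show ?thesis .
qed

end

subsection \<open>Asymptotics\<close>

text \<open>Here polynomial growth enters: the logarithm of the total supply is
  \<open>O(ln n)\<close>.\<close>

lemma ln_sum_le_of_growth:
  fixes N :: "nat \<Rightarrow> int" and a p :: real
  assumes "a \<ge> 0" "p \<ge> 0" "\<And>i. real_of_int (N i) \<le> a * (real i + 1) powr p" "n \<ge> 1"
    and total_nonneg: "real_of_int (\<Sum>l<n. N l) \<ge> 0"
  shows "ln (1 + real_of_int (\<Sum>l<n. N l)) \<le> ln (1 + a) + (p + 1) * ln n"
proof -
  have "real_of_int (\<Sum>l<n. N l) \<le> (\<Sum>l<n. a * real n powr p)"
    unfolding of_int_sum
  proof (intro sum_mono)
    fix l assume "l \<in> {..<n}"
    then have "a * (real l + 1) powr p \<le> a * real n powr p"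
      using assms by (intro mult_left_mono powr_mono2) auto
    with assms(3) [of l] show "real_of_int (N l) \<le> a * real n powr p" by linarith
  qed
  also have "\<dots> = a * real n powr (p + 1)"
    using assms by (simp add: powr_add)
  finally have "1 + real_of_int (\<Sum>l<n. N l) \<le> 1 + a * real n powr (p + 1)" by simp
  also have "\<dots> \<le> (1 + a) * real n powr (p + 1)"
    using assms ge_one_powr_ge_zero [of "real n" "p + 1"] by (simp add: distrib_right)
  finally have "ln (1 + real_of_int (\<Sum>l<n. N l)) \<le> ln ((1 + a) * real n powr (p + 1))"
    using total_nonneg by (intro ln_mono) auto
  also have "\<dots> = ln (1 + a) + (p + 1) * ln n"
    using assms by (simp add: ln_mult ln_powr)
  finally show ?thesis .
qed

theorem theorem1p6:
  fixes N :: "nat \<Rightarrow> int" and a p :: real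
  assumes pos: "\<And>i. N i > 0"
    and a: "a \<ge> 0" and p: "p \<ge> 0"
    and growth: "\<And>i. real_of_int (N i) \<le> a * (real i + 1) powr p"
  shows "(\<lambda>n. ln (real (lattice_count n (netflow_vec N n)))
            / Sup (flow_entropy n (netflow_vec N n) ` flow_polytope n (netflow_vec N n)))
         \<longlonglongrightarrow> 1"
proof -
  define logK where "logK n = ln (real (lattice_count n (netflow_vec N n)))" for n
  define supH where "supH n = Sup (flow_entropy n (netflow_vec N n) ` flow_polytope n (netflow_vec N n))" for n
  define B q where "B = ln (1 + a)" and "q = p + 1"
  \<comment> \<open>Then \<open>\<theta> n * ln n\<close> tends to 0, so \<open>\<kappa> n\<close>
    tends to 1, while \<open>n * ln (1 / \<epsilon> n) / \<theta> n\<close> is of order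
    \<open>n * (ln n)^(3/2) * ln (ln n)\<close>, below \<open>n * (ln n)^2\<close>.\<close>
  define \<epsilon> \<theta> where "\<epsilon> n = ln (real n) powr (- 1 / 2)" and "\<theta> n = ln (real n) powr (- 3 / 2)" for n :: nat
  define \<kappa> where "\<kappa> n = (1 - \<epsilon> n) * exp (- 3 * \<theta> n * ln n) / (1 + \<theta> n)" for n :: nat
  define err where "err n = (1 + \<theta> n) / \<theta> n * n * ln (1 / \<epsilon> n) + 2 * n * (B + q * ln n + 1) + 3 * n" for n :: nat
  \<comment> \<open>A smooth minorant of the bound in \<open>Sup_flow_entropy_ge\<close> at
    \<open>m = n div 3\<close>.\<close>
  define low where "low n = (real n / 3 - 1) * (((ln (real n / 3))\<^sup>2 - (ln 2)\<^sup>2) / 2)" for n :: nat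
  have lim: "(\<lambda>n. \<kappa> n - err n / low n) \<longlonglongrightarrow> 1"
    unfolding \<kappa>_def err_def low_def \<epsilon>_def \<theta>_def by real_asymp
  have low_pos: "eventually (\<lambda>n. low n > 0) sequentially"
    unfolding low_def by real_asymp
  have err_nonneg: "eventually (\<lambda>n. err n \<ge> 0) sequentially"
    unfolding err_def \<epsilon>_def \<theta>_def by real_asymp
  have \<epsilon>: "eventually (\<lambda>n. 0 < \<epsilon> n \<and> \<epsilon> n < 1) sequentially" "eventually (\<lambda>n. 0 < \<theta> n) sequentially"
    unfolding \<epsilon>_def \<theta>_def by (intro eventually_conj; real_asymp) real_asymp
  have bounds: "eventually (\<lambda>n. \<kappa> n - err n / low n \<le> logK n / supH n \<and> logK n / supH n \<le> 1) sequentially"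
    using low_pos err_nonneg \<epsilon> eventually_ge_at_top [of 6]
  proof eventually_elim
    case (elim n)
    \<comment> \<open>\<open>n \<ge> 6\<close> gives \<open>ln 2 \<le> ln (n / 3)\<close>, so the
      difference of squares is nonnegative.\<close>
    have "low n \<le> (n div 3) * (((ln (n div 3 + 1))\<^sup>2 - (ln 2)\<^sup>2) / 2)"
    proof -
      have d: "real n / 3 - 1 \<le> real (n div 3)" "real n / 3 \<le> real (n div 3) + 1" by linarith+
      have "ln (real n / 3) \<le> ln (real (n div 3) + 1)"
        using d elim by (intro ln_mono) auto
      moreover have "ln 2 \<le> ln (real n / 3)" using elim by (intro ln_mono) auto
      moreover have "0 \<le> ln (2 :: real)" "0 \<le> ln (real n / 3)" using elim by auto
      ultimately have "(ln 2)\<^sup>2 \<le> (ln (real n / 3))\<^sup>2"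
        "(ln (real n / 3))\<^sup>2 \<le> (ln (real (n div 3) + 1))\<^sup>2"
        by (auto intro!: power_mono)
      then show ?thesis
        unfolding low_def using d elim by (intro mult_mono divide_right_mono) (auto simp: add.commute)
    qed
    also have "\<dots> \<le> supH n"
      unfolding supH_def using Sup_flow_entropy_ge [OF pos, of "n div 3" n] by (simp add: add.commute)
    finally have low_le: "low n \<le> supH n" .
    with elim have sup_pos: "supH n > 0" by linarith
    have upper: "logK n \<le> supH n"
      unfolding logK_def supH_def by (intro ln_lattice_count_le_Sup lattice_flows_nonempty pos)
    have "\<theta> n * ln n \<ge> 0" using elim by simp
    then have \<kappa>: "\<kappa> n > 0" using elim by (simp add: \<kappa>_def)
    have ln_total: "ln (1 + real_of_int (\<Sum>l<n. N l)) \<le> B + q * ln n"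
      unfolding B_def q_def using elim
      by (intro ln_sum_le_of_growth a p growth total_supply_nonneg pos) auto
    have "flow_entropy n (netflow_vec N n) f \<le> (logK n + err n) / \<kappa> n"
      if f: "f \<in> flow_polytope n (netflow_vec N n)" for f
    proof -
      have "\<kappa> n * flow_entropy n (netflow_vec N n) f \<le> logK n +
        ((1 + \<theta> n) / \<theta> n * n * ln (1 / \<epsilon> n) + 2 * n * (ln (1 + real_of_int (\<Sum>l<n. N l)) + 1) + 3 * n)"
        unfolding \<kappa>_def logK_def using elim
        by (intro flow_entropy_le_ln_lattice_count [OF pos f]) auto
      also have "\<dots> \<le> logK n + err n"
        unfolding err_def using ln_total by (intro add_left_mono add_right_mono mult_left_mono) auto
      finally show ?thesis using \<kappa> by (simp add: le_divide_eq mult.commute)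
    qed
    moreover have "flow_polytope n (netflow_vec N n) \<noteq> {}"
      using lattice_flows_nonempty [of N n, OF pos] by blast
    ultimately have "supH n \<le> (logK n + err n) / \<kappa> n"
      unfolding supH_def by (intro cSup_least) auto
    \<comment> \<open>Divide by \<open>supH n\<close>; as \<open>err n\<close> is nonnegative, the
      error may then be measured against the smaller \<open>low n\<close>.\<close>
    then have "\<kappa> n \<le> logK n / supH n + err n / supH n"
      using \<kappa> sup_pos by (simp add: le_divide_eq mult.commute flip: add_divide_distrib)
    moreover have "err n / supH n \<le> err n / low n"
      using low_le elim by (intro divide_left_mono) auto
    ultimately have "\<kappa> n - err n / low n \<le> logK n / supH n" by linarith
    then show ?case using upper sup_pos by simp
  qed
  have "(\<lambda>n. logK n / supH n) \<longlonglongrightarrow> 1"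
    using bounds by (intro tendsto_sandwich [OF _ _ lim tendsto_const]) (auto elim: eventually_mono)
  then show ?thesis by (simp add: logK_def supH_def)
qed

end
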